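(* Fix a positive integer $l$. For $i\in\{1,\dots,l\}$ let $\alpha_i=\frac{a_i}{b_i}$ be non-integer rational numbers, with $a_i,b_i$ positive integers, such that $\gcd(b_i,b_j)=1$ for $i\ne j$. Let $(s_n)_{n\ge1}$ be the sequence obtained by rearranging the elements of the set $$\{n_1^{\alpha_1}n_2^{\alpha_2}\cdots n_l^{\alpha_l}: n_i\in\mathbb N\text{ for all }i\in\{1,\dots,l\}\}$$ in increasing order. Then for every aperiodic dynamical system $(X,\Sigma,\mu,T^t)$ and every $\epsilon>0$, there exists a set $E\in\Sigma$ such that $\mu(E)<\epsilon$, $$\limsup_{N\to\infty}\frac1N\sum_{n=1}^{N}\mathbf 1_E(T^{s_n}x)=1\quad\text{for }\mu\text{-a.e. }x\in X,$$ and $$\liminf_{N\to\infty}\frac1N\sum_{n=1}^{N}\mathbf 1_E(T^{s_n}x)=0\quad\text{for }\mu\text{-a.e. }x\in X.$$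
   Context: $\mathbb N=\{1,2,3,\dots\}$. A Lebesgue probability space $(X,\Sigma,\mu)$ is a complete, countably additive probability space that is measure-theoretically isomorphic to a measurable subset of the unit interval with Lebesgue measure. A flow $\{T^t:t\in\mathbb R\}$ is a group of measurable transformations $T^t:X\to X$ with $T^0(x)=x$ and $T^{t+s}=T^t\circ T^s$ for $s,t\in\mathbb R$. It is measurable if $(x,t)\mapsto T^t(x)$ from $X\times\mathbb R$ to $X$ is measurable with respect to the completion of the product of $\mu$ and Lebesgue measure on $\mathbb R$. It is measure preserving if it is measurable and $\mu((T^t)^{-1}A)=\mu(A)$ for all $A\in\Sigma$ and $t\in\mathbb R$. A dynamical system is a quadruple $(X,\Sigma,\mu,T^t)$ consisting of a Lebesgue probability space and a measure preserving flow on it. It is aperiodic if $\mu\{x: T^t(x)=T^s(x)\text{ for some }t\neq s\}=0$. $\mathbf 1_E$ is the indicator function of $E$. The sequence $(s_n)$ lists each element of the displayed set once. *)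

theory Defs
  imports "HOL-Probability.Probability"
begin

text \<open>Isomorphism of measure spaces is understood modulo null sets, as is standard for
  Lebesgue spaces.\<close>

definition isomorphic_mod_0 :: "'a measure \<Rightarrow> 'b measure \<Rightarrow> bool" where
  "isomorphic_mod_0 M M' \<longleftrightarrow>
    (\<exists>N \<in> null_sets M. \<exists>N' \<in> null_sets M'. \<exists>f.
      let R = restrict_space M (space M - N); R' = restrict_space M' (space M' - N') in
        bij_betw f (space R) (space R') \<and>
        f \<in> R \<rightarrow>\<^sub>M R' \<and> the_inv_into (space R) f \<in> R' \<rightarrow>\<^sub>M R \<and>
        distr R R' f = R')"

locale lebesgue_prob_space = prob_space M + complete_measure M for M :: "'a measure" +
  assumes isomorphic_unit_interval_subset:
    "\<exists>Y. Y \<in> sets lebesgue \<and> Y \<subseteq> {0..1 :: real} \<and> isomorphic_mod_0 M (lebesgue_on Y)"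

locale measurable_flow =
  fixes M :: "'a measure" and T :: "real \<Rightarrow> 'a \<Rightarrow> 'a"
  assumes transformation_measurable: "\<And>t. T t \<in> M \<rightarrow>\<^sub>M M"
    and flow_0: "\<And>x. x \<in> space M \<Longrightarrow> T 0 x = x"
    and flow_add: "\<And>s t x. x \<in> space M \<Longrightarrow> T (t + s) x = T t (T s x)"
    and jointly_measurable: "(\<lambda>(x, t). T t x) \<in> completion (M \<Otimes>\<^sub>M lebesgue) \<rightarrow>\<^sub>M M"

locale measure_preserving_flow = measurable_flow +
  assumes measure_preserving:
    "\<And>A t. A \<in> sets M \<Longrightarrow> emeasure M (T t -` A \<inter> space M) = emeasure M A"

locale dynamical_system = lebesgue_prob_space M + measure_preserving_flow M T
  for M :: "'a measure" and T :: "real \<Rightarrow> 'a \<Rightarrow> 'a"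

text \<open>Membership in \<^term>\<open>null_sets M\<close> rather than \<^term>\<open>emeasure M A = 0\<close>: the latter
  also holds for every non-measurable \<^term>\<open>A\<close>.\<close>

locale aperiodic_dynamical_system = dynamical_system +
  assumes aperiodic: "{x \<in> space M. \<exists>s t. t \<noteq> s \<and> T t x = T s x} \<in> null_sets M"

end

theory Submission
  imports Defs "HOL-Computational_Algebra.Fundamental_Theorem_Algebra"
    "HOL-Combinatorics.Permutations" "HOL-Number_Theory.Cong"
begin

text \<open>
  Write \<open>n\<^sub>i = q\<^sub>i ^ b\<^sub>i * j\<^sub>i\<close> with \<open>j\<^sub>i\<close> free of \<open>b\<^sub>i\<close>-th powers. For fixed \<open>q\<close> the numbers
  \<open>\<Prod>n\<^sub>i ^ \<alpha>\<^sub>i\<close> are integer multiples of distinct radicals, hence linearly independent over the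
  rationals (Besicovitch), and finitely many \<open>q\<close> already account for all but a small proportion of
  the sequence.

  On a finite linearly independent set of times, an aperiodic flow admits approximate cocycles with
  arbitrarily prescribed increments: an integer-valued \<open>\<phi>\<close> with \<open>\<phi> (T s x) = \<phi> x + c s\<close> off a small
  set. Choose one such \<open>\<phi>\<^sub>k\<close> modulo \<open>m\<close> for each of the \<open>K\<close> classes of times, and let \<open>E\<close> be the
  set where some \<open>\<phi>\<^sub>k\<close> takes a rare prescribed value, so that \<open>E\<close> has measure at most \<open>K / m\<close>. Over
  \<open>m ^ K\<close> rapidly growing windows of indices let the increments run through all vectors of
  \<open>(\<int>/m)\<^sup>K\<close>; then for almost every point there is a window along which nearly all of the orbit lies
  in \<open>E\<close>. Alternately adding and removing such sets, with rapidly decreasing measures, produces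
  oscillation between 0 and 1.
\<close>

section \<open>Linear independence of real radicals\<close>

text \<open>An exact relation \<open>\<phi> (T s x) = \<phi> x + c s\<close> forces \<open>c\<close>
  to respect every integer relation among the times, so increments can be free only at independent
  times. The full sequence is dependent: multiplying one \<open>n\<close> by \<open>q ^ b\<close>
  multiplies the value by the integer \<open>q ^ a\<close>. Hence the times are split into classes
  with one cocycle each, and the resulting sets are united. This costs a factor \<open>K\<close> in
  measure, so \<open>K\<close> has to be fixed before \<open>m\<close>, and the arithmetic must
  supply finitely many classes that miss only a small proportion of the indices, uniformly in
  \<open>N\<close>.

  The exponents being non-integers gives reduced denominators at least 2; the missed indices, which
  have a large \<open>b\<close>-th power in some factor, are then controlled by a tail of the series
  of inverse squares. Coprimality of the denominators acts twice: it makes ratios of distinct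
  radicals irrational, and it makes the exponents distinct, so that a single smallest exponent
  governs the growth of the sequence.\<close>

interpretation rat_vs: vector_space "\<lambda>(r::rat) (x::real). of_rat r * x"
  by unfold_locales (simp_all add: algebra_simps of_rat_add of_rat_mult)

text \<open>The target field stays polymorphic so that one rational polynomial can be evaluated both
  at the real radical and at complex roots, where it splits into linear factors.\<close>

definition rpoly :: "rat poly \<Rightarrow> 'a::field_char_0 \<Rightarrow> 'a" where
  "rpoly P x = poly (map_poly of_rat P) x"

lemma map_poly_of_rat_add:
  "map_poly of_rat (P + Q) = map_poly of_rat P + (map_poly of_rat Q :: 'a::field_char_0 poly)"
  by (intro poly_eqI) (simp add: coeff_map_poly of_rat_add)

lemma map_poly_of_rat_mult:
  "map_poly of_rat (P * Q) = map_poly of_rat P * (map_poly of_rat Q :: 'a::field_char_0 poly)"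
  by (intro poly_eqI) (simp add: coeff_map_poly coeff_mult of_rat_sum of_rat_mult)

lemma rpoly_add [simp]: "rpoly (P + Q) x = rpoly P x + rpoly Q x"
  by (simp add: rpoly_def map_poly_of_rat_add)

lemma rpoly_mult [simp]: "rpoly (P * Q) x = rpoly P x * rpoly Q x"
  by (simp add: rpoly_def map_poly_of_rat_mult)

lemma rpoly_const [simp]: "rpoly [:c:] x = of_rat c"
  by (simp add: rpoly_def map_poly_pCons)

lemma rpoly_pCons: "rpoly (pCons c P) x = of_rat c + x * rpoly P x"
  by (simp add: rpoly_def map_poly_pCons)

lemma rpoly_monom [simp]: "rpoly (monom c n) x = of_rat c * x ^ n"
  by (simp add: rpoly_def map_poly_monom poly_monom)

lemma rpoly_0 [simp]: "rpoly 0 x = 0"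
  by (simp add: rpoly_def)

lemma rpoly_power_minus_const:
  "rpoly (monom 1 e - [:B:]) x = x ^ e - of_rat B"
proof -
  have "monom 1 e - [:B:] = monom 1 e + [:- B:]" by simp
  then show ?thesis by (simp only: rpoly_add rpoly_monom rpoly_const) (simp add: of_rat_minus)
qed

lemma cmod_of_rat: "cmod (of_rat r) = \<bar>of_rat r\<bar>"
proof -
  have "(of_rat r :: complex) = complex_of_real (of_rat r)" by (cases r) (simp add: of_rat_rat)
  then show ?thesis by (metis norm_of_real)
qed

text \<open>All complex roots of \<^term>\<open>P\<close> have modulus \<^term>\<open>z\<close>, so its constant coefficient forces the rationality of
  \<open>z ^ degree P\<close>.\<close>

lemma dvd_power_minus_const_degree:
  fixes P :: "rat poly" and z :: real
  assumes dvd: "P dvd monom 1 e - [:B:]" and e: "0 < e" and z: "0 < z" "z ^ e = of_rat B"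
    and irr: "\<And>m. 0 < m \<Longrightarrow> m < e \<Longrightarrow> z ^ m \<notin> \<rat>"
  shows "degree P = 0 \<or> degree P = e"
proof (rule ccontr)
  assume neg: "\<not> ?thesis"
  have deg: "degree (monom 1 e - [:B:]) = e"
    using e by (metis degree_add_eq_left degree_monom_eq degree_pCons_0 diff_conv_add_uminus degree_minus one_neq_zero)
  have nz: "monom 1 e - [:B:] \<noteq> 0" using deg e by auto
  have le: "degree P \<le> e" using dvd_imp_degree_le[OF dvd nz] deg by simp
  have P0: "P \<noteq> 0" using dvd nz by auto
  let ?Pc = "map_poly (of_rat :: rat \<Rightarrow> complex) P"
  have dc: "degree ?Pc = degree P" by (rule degree_map_poly) auto
  have lc: "lead_coeff ?Pc = of_rat (lead_coeff P)" using dc by (simp add: coeff_map_poly)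
  obtain r where r: "smult (lead_coeff ?Pc) (\<Prod>i<degree P. [:-r i, 1:]) = ?Pc"
    using complex_poly_decompose'[of ?Pc] dc by metis
  have lnz: "lead_coeff ?Pc \<noteq> 0" using lc P0 by simp
  have root: "cmod (r i) = z" if "i < degree P" for i
  proof -
    have "poly ?Pc (r i) = 0"
      using that by (subst r[symmetric]) (auto simp: poly_prod)
    then have "rpoly P (r i) = 0" by (simp add: rpoly_def)
    then have "rpoly (monom 1 e - [:B:]) (r i) = 0" using dvd by (auto elim!: dvdE)
    then have "r i ^ e = of_rat B" by (simp only: rpoly_power_minus_const) simp
    then have "cmod (r i) ^ e = cmod (of_rat B)" by (metis norm_power)
    also have "\<dots> = \<bar>of_rat B :: real\<bar>" by (rule cmod_of_rat)
    also have "\<dots> = z ^ e" using z by (metis abs_of_pos zero_less_power)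
    finally show ?thesis using e z by (metis norm_ge_zero power_eq_imp_eq_base less_imp_le)
  qed
  have "poly ?Pc 0 = lead_coeff ?Pc * (\<Prod>i<degree P. - r i)"
    by (subst r[symmetric]) (simp add: poly_prod)
  then have "cmod (poly ?Pc 0) = cmod (lead_coeff ?Pc) * (\<Prod>i<degree P. cmod (r i))"
    by (simp add: norm_mult flip: prod_norm)
  then have *: "cmod (poly ?Pc 0) = cmod (lead_coeff ?Pc) * z ^ degree P"
    using root by simp
  have "poly ?Pc 0 = of_rat (coeff P 0)" by (simp add: poly_0_coeff_0 coeff_map_poly)
  moreover have ab: "\<bar>of_rat r\<bar> = (of_rat \<bar>r\<bar> :: real)" for r
    by (simp add: abs_if of_rat_minus)
  ultimately have a: "cmod (poly ?Pc 0) = of_rat \<bar>coeff P 0\<bar>"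
    by (simp add: cmod_of_rat)
  have b: "cmod (lead_coeff ?Pc) = of_rat \<bar>lead_coeff P\<bar>"
    using lc by (simp add: cmod_of_rat ab)
  have "z ^ degree P = of_rat \<bar>coeff P 0\<bar> / of_rat \<bar>lead_coeff P\<bar>"
    using * P0 unfolding a b by (simp add: field_simps)
  then have "z ^ degree P \<in> \<rat>" by auto
  then show False using irr[of "degree P"] neg le by auto
qed

text \<open>The trace of the operator \<open>v \<mapsto> z * v\<close> on the rational span of
  \<open>B\<close>, as a sum of diagonal matrix entries. It stands in for the field trace and avoids
  building a number field; it is meaningful when \<open>B\<close> is a finite basis of a space
  stable under \<open>z\<close>.\<close>

definition mult_trace :: "real set \<Rightarrow> real \<Rightarrow> rat" where
  "mult_trace B z = (\<Sum>b\<in>B. rat_vs.representation B (z * b) b)"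

text \<open>This is \<open>tr (X Y) = tr (Y X)\<close>: with \<open>X\<close> holding the
  \<open>B'\<close>-coordinates of \<open>z * b\<close> and \<open>Y\<close> the
  \<open>B\<close>-coordinates of \<open>b'\<close>, both traces expand to the same double sum in
  opposite orders. The trace may thus be computed in whichever basis suits \<open>z\<close>.\<close>

lemma mult_trace_cong_basis:
  assumes "finite B" "finite B'" "rat_vs.independent B" "rat_vs.independent B'"
    and sp: "rat_vs.span B = rat_vs.span B'" and closed: "\<And>v. v \<in> rat_vs.span B \<Longrightarrow> z * v \<in> rat_vs.span B"
  shows "mult_trace B z = mult_trace B' z"
proof -
  have zb: "z * b \<in> rat_vs.span B" if "b \<in> B" for b
    using closed that by (simp add: rat_vs.span_base)
  have b': "b' \<in> rat_vs.span B" if "b' \<in> B'" for b'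
    using that sp by (simp add: rat_vs.span_base)
  have "mult_trace B z = (\<Sum>b\<in>B. \<Sum>b'\<in>B'. rat_vs.representation B' (z * b) b' * rat_vs.representation B b' b)"
    unfolding mult_trace_def
  proof (rule sum.cong[OF refl])
    fix b assume b: "b \<in> B"
    have "z * b = (\<Sum>b'\<in>B'. of_rat (rat_vs.representation B' (z * b) b') * b')"
      by (rule rat_vs.sum_representation_eq[symmetric]) (use assms zb b in auto)
    then have "rat_vs.representation B (z * b) = 
       rat_vs.representation B (\<Sum>b'\<in>B'. of_rat (rat_vs.representation B' (z * b) b') * b')" by simp
    also have "\<dots> = (\<lambda>c. \<Sum>b'\<in>B'. rat_vs.representation B (of_rat (rat_vs.representation B' (z * b) b') * b') c)"
      by (rule rat_vs.representation_sum) (use assms b' rat_vs.span_scale in auto)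
    finally show "rat_vs.representation B (z * b) b = (\<Sum>b'\<in>B'. rat_vs.representation B' (z * b) b' * rat_vs.representation B b' b)"
      using assms b' by (simp add: rat_vs.representation_scale)
  qed
  also have "\<dots> = (\<Sum>b'\<in>B'. \<Sum>b\<in>B. rat_vs.representation B b' b * rat_vs.representation B' (z * b) b')"
    by (subst sum.swap) (simp add: mult.commute)
  also have "\<dots> = mult_trace B' z"
    unfolding mult_trace_def
  proof (rule sum.cong[OF refl])
    fix c assume c: "c \<in> B'"
    have "c = (\<Sum>b\<in>B. of_rat (rat_vs.representation B c b) * b)"
      by (rule rat_vs.sum_representation_eq[symmetric]) (use assms b' c in auto)
    then have "z * c = z * (\<Sum>b\<in>B. of_rat (rat_vs.representation B c b) * b)" by simp
    then have "z * c = (\<Sum>b\<in>B. of_rat (rat_vs.representation B c b) * (z * b))"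
      by (simp add: sum_distrib_left mult_ac)
    then have "rat_vs.representation B' (z * c) = rat_vs.representation B' (\<Sum>b\<in>B. of_rat (rat_vs.representation B c b) * (z * b))" by simp
    also have "\<dots> = (\<lambda>d. \<Sum>b\<in>B. rat_vs.representation B' (of_rat (rat_vs.representation B c b) * (z * b)) d)"
      by (rule rat_vs.representation_sum) (use assms zb rat_vs.span_scale in auto)
    finally show "(\<Sum>b\<in>B. rat_vs.representation B c b * rat_vs.representation B' (z * b) c) = rat_vs.representation B' (z * c) c"
      using assms zb by (simp add: rat_vs.representation_scale)
  qed
  finally show ?thesis .
qed

lemma mult_trace_sum:
  assumes "finite B" "rat_vs.independent B"
    and closed: "\<And>i b. i \<in> I \<Longrightarrow> b \<in> B \<Longrightarrow> z i * b \<in> rat_vs.span B"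
  shows "mult_trace B (\<Sum>i\<in>I. of_rat (c i) * z i) = (\<Sum>i\<in>I. c i * mult_trace B (z i))"
proof -
  have "rat_vs.representation B ((\<Sum>i\<in>I. of_rat (c i) * z i) * b) b = (\<Sum>i\<in>I. c i * rat_vs.representation B (z i * b) b)"
    if b: "b \<in> B" for b
  proof -
    have "(\<Sum>i\<in>I. of_rat (c i) * z i) * b = (\<Sum>i\<in>I. of_rat (c i) * (z i * b))"
      by (simp add: sum_distrib_left sum_distrib_right mult_ac)
    then show ?thesis using assms(2) closed b
      by (simp add: rat_vs.representation_sum rat_vs.representation_scale rat_vs.span_scale)
  qed
  then show ?thesis unfolding mult_trace_def
    by (simp add: sum_distrib_left sum.swap[of _ I])
qed

lemma mult_trace_1: "rat_vs.independent B \<Longrightarrow> mult_trace B 1 = of_nat (card B)"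
  unfolding mult_trace_def by (simp add: rat_vs.representation_basis)

section \<open>Bases adapted to multiplication by a radical\<close>

lemma rpoly_mult_mem:
  assumes "rat_vs.subspace W" "\<And>w. w \<in> W \<Longrightarrow> z * w \<in> W" "w \<in> W"
  shows "rpoly P z * w \<in> W"
proof (induction P)
  case 0
  then show ?case using assms by (simp add: rat_vs.subspace_0)
next
  case (pCons c P)
  have "rpoly (pCons c P) z * w = of_rat c * w + z * (rpoly P z * w)"
    by (simp add: rpoly_pCons algebra_simps)
  then show ?case using assms pCons by (auto intro: rat_vs.subspace_add rat_vs.subspace_scale)
qed

text \<open>The polynomials \<open>S\<close> with \<open>rpoly S z * v \<in> W\<close> form an ideal
  containing \<open>X ^ e - B\<close>. Division with remainder shows that a nonzero member
  \<open>R\<close> of least degree divides \<open>X ^ e - B\<close>, so its degree is 0 or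
  \<open>e\<close>. Degree 0 would put \<open>v\<close> into \<open>W\<close>, and degree
  \<open>e\<close> exceeds that of \<open>P\<close>.\<close>

lemma rpoly_mult_notin:
  fixes z :: real
  assumes e: "0 < e" and z: "0 < z" "z ^ e = of_rat B"
    and irr: "\<And>m. 0 < m \<Longrightarrow> m < e \<Longrightarrow> z ^ m \<notin> \<rat>"
    and W: "rat_vs.subspace W" "\<And>w. w \<in> W \<Longrightarrow> z * w \<in> W" and v: "v \<notin> W"
    and P: "P \<noteq> 0" "degree P < e"
  shows "rpoly P z * v \<notin> W"
proof
  assume mem: "rpoly P z * v \<in> W"
  define R where "R = (ARG_MIN degree S. S \<noteq> 0 \<and> rpoly S z * v \<in> W)"
  have R: "R \<noteq> 0" "rpoly R z * v \<in> W"
    using arg_min_natI[of "\<lambda>S. S \<noteq> 0 \<and> rpoly S z * v \<in> W" P degree] P mem unfolding R_def by auto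
  have min: "degree R \<le> degree S" if "S \<noteq> 0" "rpoly S z * v \<in> W" for S
    using arg_min_nat_le[of "\<lambda>S. S \<noteq> 0 \<and> rpoly S z * v \<in> W" S degree] that unfolding R_def by auto
  let ?f = "monom 1 e - [:B:]"
  have "rpoly (?f mod R) z * v \<in> W"
  proof -
    have "?f = ?f div R * R + ?f mod R" by simp
    then have "rpoly ?f z = rpoly (?f div R) z * rpoly R z + rpoly (?f mod R) z"
      by (metis rpoly_add rpoly_mult)
    then have "rpoly (?f mod R) z * v = of_rat (-1) * (rpoly (?f div R) z * (rpoly R z * v))"
      unfolding rpoly_power_minus_const using z by (simp add: algebra_simps add_eq_0_iff)
    then show ?thesis using rpoly_mult_mem[OF W R(2)] W(1) by (metis rat_vs.subspace_scale)
  qed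
  then have "?f mod R = 0"
    using min[of "?f mod R"] degree_mod_less[of R ?f] R(1) by (metis linorder_not_less)
  then have "degree R = 0 \<or> degree R = e"
    by (intro dvd_power_minus_const_degree[OF _ e z irr]) auto
  moreover have "degree R < e" using min[OF P(1) mem] P by simp
  ultimately obtain c where "R = [:c:]" by (metis degree_eq_zeroE less_irrefl)
  with R have "c \<noteq> 0" "of_rat c * v \<in> W" by auto
  then have "of_rat (1 / c) * (of_rat c * v) \<in> W" using W(1) rat_vs.subspace_scale by blast
  also have "of_rat (1 / c) * (of_rat c * v) = v" using \<open>c \<noteq> 0\<close> by (simp add: of_rat_divide)
  finally show False using v by simp
qed

text \<open>A dependence of \<open>z ^ k * v\<close> on the earlier vectors yields a monic
  polynomial of degree \<open>k < e\<close> whose value at \<open>z\<close> multiplies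
  \<open>v\<close> into the span of \<open>A\<close>; \<open>rpoly_mult_notin\<close> excludes
  this.\<close>

lemma power_basis_extend:
  fixes z :: real
  assumes e: "0 < e" and z: "0 < z" "z ^ e = of_rat B"
    and irr: "\<And>m. 0 < m \<Longrightarrow> m < e \<Longrightarrow> z ^ m \<notin> \<rat>"
    and A: "rat_vs.independent A" and W: "\<And>w. w \<in> rat_vs.span A \<Longrightarrow> z * w \<in> rat_vs.span A"
    and v: "v \<notin> rat_vs.span A" and k: "k \<le> e"
  shows "rat_vs.independent (A \<union> (\<lambda>i. z ^ i * v) ` {..<k})"
  using k
proof (induction k)
  case 0
  then show ?case using A by simp
next
  case (Suc k)
  \<comment> \<open>The alternative \<open>P = 0\<close> matters for \<open>k = 0\<close>: the zero
    polynomial has degree 0, which is not below \<open>k\<close>.\<close>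
  let ?U = "{w + rpoly P z * v | w P. w \<in> rat_vs.span A \<and> (P = 0 \<or> degree P < k)}"
  have "rat_vs.subspace ?U"
  proof (rule rat_vs.subspaceI)
    show "0 \<in> ?U" by (rule CollectI, rule exI[of _ 0], rule exI[of _ 0]) (simp add: rat_vs.span_zero)
  next
    fix x y assume "x \<in> ?U" "y \<in> ?U"
    then obtain w P w' P' where h: "w \<in> rat_vs.span A" "P = 0 \<or> degree P < k" "x = w + rpoly P z * v"
      "w' \<in> rat_vs.span A" "P' = 0 \<or> degree P' < k" "y = w' + rpoly P' z * v" by blast
    have "x + y = (w + w') + rpoly (P + P') z * v" using h by (simp add: algebra_simps)
    moreover have "P + P' = 0 \<or> degree (P + P') < k" using h by (metis add_0 add_0_right degree_add_less)
    ultimately show "x + y \<in> ?U" using h rat_vs.span_add by blast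
  next
    fix c x assume "x \<in> ?U"
    then obtain w P where h: "w \<in> rat_vs.span A" "P = 0 \<or> degree P < k" "x = w + rpoly P z * v" by blast
    have "of_rat c * x = of_rat c * w + rpoly ([:c:] * P) z * v"
      unfolding h rpoly_mult rpoly_const by (simp add: algebra_simps)
    moreover have "[:c:] * P = 0 \<or> degree ([:c:] * P) < k" using h by auto
    ultimately show "of_rat c * x \<in> ?U" using h rat_vs.span_scale by blast
  qed
  moreover have "A \<union> (\<lambda>i. z ^ i * v) ` {..<k} \<subseteq> ?U"
  proof -
    have "a \<in> ?U" if "a \<in> A" for a
      by (rule CollectI, rule exI[of _ a], rule exI[of _ 0]) (use that in \<open>simp add: rat_vs.span_base\<close>)
    moreover have "z ^ i * v \<in> ?U" if "i < k" for i
      by (rule CollectI, rule exI[of _ 0], rule exI[of _ "monom 1 i"])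
        (use that in \<open>simp add: rat_vs.span_zero degree_monom_eq\<close>)
    ultimately show ?thesis by blast
  qed
  ultimately have sub: "rat_vs.span (A \<union> (\<lambda>i. z ^ i * v) ` {..<k}) \<subseteq> ?U" by (rule rat_vs.span_minimal[rotated])
  have "z ^ k * v \<notin> rat_vs.span (A \<union> (\<lambda>i. z ^ i * v) ` {..<k})"
  proof
    assume "z ^ k * v \<in> rat_vs.span (A \<union> (\<lambda>i. z ^ i * v) ` {..<k})"
    then obtain w P where h: "w \<in> rat_vs.span A" "P = 0 \<or> degree P < k" "z ^ k * v = w + rpoly P z * v" using sub by blast
    have deg: "degree (monom 1 k + [:-1:] * P) = k \<and> monom 1 k + [:-1:] * P \<noteq> 0"
    proof -
      have "coeff (monom 1 k + [:-1:] * P) k = 1" using h by (auto simp: coeff_eq_0)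
      moreover have "degree (monom 1 k + [:-1:] * P) \<le> k" using h by (intro degree_add_le) (auto simp: degree_monom_eq)
      ultimately show ?thesis by (metis coeff_0 le_antisym le_degree zero_neq_one)
    qed
    have "rpoly (monom 1 k + [:-1:] * P) z * v = w"
      using h unfolding rpoly_add rpoly_mult rpoly_const by (simp add: algebra_simps)
    moreover have "rpoly (monom 1 k + [:-1:] * P) z * v \<notin> rat_vs.span A"
      by (rule rpoly_mult_notin[OF e z irr rat_vs.subspace_span W v]) (use deg Suc.prems in auto)
    ultimately show False using h by simp
  qed
  moreover have "A \<union> (\<lambda>i. z ^ i * v) ` {..<Suc k} = insert (z ^ k * v) (A \<union> (\<lambda>i. z ^ i * v) ` {..<k})"
    by (auto simp: lessThan_Suc)
  ultimately show ?case using Suc by (simp add: rat_vs.independent_insert)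
qed

text \<open>Vectors of \<open>S\<close> not yet spanned are added one at a time, each with its whole
  block of \<open>e\<close> powers. The span of a union of blocks is stable under \<open>z\<close>
  because the last power wraps round to the rational multiple \<open>B\<close> of \<open>c\<close>,
  and this stability is what allows the next block to be appended.\<close>

lemma exists_power_basis:
  fixes z :: real
  assumes e: "0 < e" and z: "0 < z" "z ^ e = of_rat B"
    and irr: "\<And>m. 0 < m \<Longrightarrow> m < e \<Longrightarrow> z ^ m \<notin> \<rat>"
    and V: "rat_vs.subspace V" "\<And>w. w \<in> V \<Longrightarrow> z * w \<in> V" and S: "finite S" "S \<subseteq> V"
  shows "\<exists>C. finite C \<and> C \<subseteq> V \<and> rat_vs.independent (\<Union>c\<in>C. (\<lambda>i. z ^ i * c) ` {..<e}) \<and>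
     S \<subseteq> rat_vs.span (\<Union>c\<in>C. (\<lambda>i. z ^ i * c) ` {..<e})"
  using S
proof (induction S)
  case empty
  then show ?case using rat_vs.independent_empty by (intro exI[of _ "{}"]) auto
next
  case (insert v S)
  then obtain C where C: "finite C" "C \<subseteq> V" "rat_vs.independent (\<Union>c\<in>C. (\<lambda>i. z ^ i * c) ` {..<e})"
     "S \<subseteq> rat_vs.span (\<Union>c\<in>C. (\<lambda>i. z ^ i * c) ` {..<e})" by auto
  let ?A = "\<Union>c\<in>C. (\<lambda>i. z ^ i * c) ` {..<e}"
  show ?case
  proof (cases "v \<in> rat_vs.span ?A")
    case True
    then show ?thesis using C by auto
  next
    case False
    have gen: "z * a \<in> rat_vs.span ?A" if a: "a \<in> ?A" for a
    proof -
      obtain c i where ci: "c \<in> C" "i < e" "a = z ^ i * c" using a by auto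
      show ?thesis
      proof (cases "Suc i < e")
        case True
        then have "z * a \<in> ?A" using ci by (auto intro!: bexI[of _ c] image_eqI[of _ _ "Suc i"] simp: mult_ac)
        then show ?thesis by (rule rat_vs.span_base)
      next
        case False
        with ci have "e = Suc i" by simp
        then have "z * a = of_rat B * (z ^ 0 * c)" using z ci by (simp add: mult_ac)
        moreover have "z ^ 0 * c \<in> ?A" using ci e by blast
        ultimately show ?thesis using rat_vs.span_base rat_vs.span_scale by metis
      qed
    qed
    have cl: "z * w \<in> rat_vs.span ?A" if "w \<in> rat_vs.span ?A" for w
      using that
    proof (induction rule: rat_vs.span_induct_alt)
      case base
      then show ?case by (simp add: rat_vs.span_zero)
    next
      case (step c x y)
      have "z * (of_rat c * x + y) = of_rat c * (z * x) + z * y" by (simp add: algebra_simps)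
      then show ?case using step gen rat_vs.span_add rat_vs.span_scale by metis
    qed
    have "rat_vs.independent (?A \<union> (\<lambda>i. z ^ i * v) ` {..<e})"
      by (rule power_basis_extend[OF e z irr C(3) cl False order_refl])
    moreover have eq: "(\<Union>c\<in>insert v C. (\<lambda>i. z ^ i * c) ` {..<e}) = ?A \<union> (\<lambda>i. z ^ i * v) ` {..<e}" by auto
    moreover have "v \<in> rat_vs.span (\<Union>c\<in>insert v C. (\<lambda>i. z ^ i * c) ` {..<e})"
      by (rule rat_vs.span_base) (use e in \<open>auto intro!: image_eqI[of _ _ 0]\<close>)
    moreover have "S \<subseteq> rat_vs.span (\<Union>c\<in>insert v C. (\<lambda>i. z ^ i * c) ` {..<e})"
      using C(4) rat_vs.span_mono[of ?A "\<Union>c\<in>insert v C. (\<lambda>i. z ^ i * c) ` {..<e}"] by auto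
    ultimately show ?thesis using C insert.prems by (intro exI[of _ "insert v C"]) auto
  qed
qed

text \<open>In a basis made of blocks \<open>c, z * c, \<dots>, z ^ (e - 1) * c\<close>, with \<open>e\<close> minimal such that \<open>z ^ e\<close> is
  rational, multiplication by \<open>z\<close> permutes the basis up to scalars without fixing any line.\<close>

lemma mult_trace_irrational_radical:
  assumes D: "finite D" "rat_vs.independent D"
    and cl: "\<And>v. v \<in> rat_vs.span D \<Longrightarrow> z * v \<in> rat_vs.span D"
    and z: "0 < z" "z \<notin> \<rat>" and N: "0 < N" "z ^ N \<in> \<rat>"
  shows "mult_trace D z = 0"
proof -
  define e where "e = (LEAST n. 0 < n \<and> z ^ n \<in> \<rat>)"
  have e: "0 < e" "z ^ e \<in> \<rat>"
    using LeastI[of "\<lambda>n. 0 < n \<and> z ^ n \<in> \<rat>" N] N unfolding e_def by auto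
  have min: "z ^ m \<notin> \<rat>" if "0 < m" "m < e" for m
    using not_less_Least[of m "\<lambda>n. 0 < n \<and> z ^ n \<in> \<rat>"] that unfolding e_def by auto
  have e2: "2 \<le> e" using e z(2) by (cases "e = 1") auto
  obtain B where B: "z ^ e = of_rat B" using e(2) by (auto elim: Rats_cases)
  have zi: "z ^ i \<noteq> z ^ j" if "i \<noteq> j" for i j
  proof
    assume "z ^ i = z ^ j"
    then have "real i * ln z = real j * ln z" using z(1) by (metis ln_realpow)
    moreover have "ln z \<noteq> 0" using z by (metis Rats_1 ln_eq_zero_iff)
    ultimately show False using that by simp
  qed
  obtain C where C: "finite C" "C \<subseteq> rat_vs.span D" "rat_vs.independent (\<Union>c\<in>C. (\<lambda>i. z ^ i * c) ` {..<e})"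
     "D \<subseteq> rat_vs.span (\<Union>c\<in>C. (\<lambda>i. z ^ i * c) ` {..<e})"
    using exists_power_basis[OF e(1) z(1) B min rat_vs.subspace_span cl D(1) rat_vs.span_superset] by blast
  let ?A = "\<Union>c\<in>C. (\<lambda>i. z ^ i * c) ` {..<e}"
  have pw: "z ^ i * c \<in> rat_vs.span D" if "c \<in> C" for c i
    using that C(2) cl by (induction i) (auto simp: mult.assoc)
  have sp: "rat_vs.span D = rat_vs.span ?A"
  proof
    show "rat_vs.span D \<subseteq> rat_vs.span ?A" using C(4) by (simp add: rat_vs.span_minimal rat_vs.subspace_span)
    have "?A \<subseteq> rat_vs.span D" using pw by blast
    then show "rat_vs.span ?A \<subseteq> rat_vs.span D" by (simp add: rat_vs.span_minimal rat_vs.subspace_span)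
  qed
  have "mult_trace D z = mult_trace ?A z"
    by (rule mult_trace_cong_basis) (use D C sp cl in auto)
  also have "\<dots> = 0"
    unfolding mult_trace_def
  proof (rule sum.neutral, rule ballI)
    fix a assume a: "a \<in> ?A"
    then obtain c i where ci: "c \<in> C" "i < e" "a = z ^ i * c" by auto
    have a0: "a \<noteq> 0" using a C(3) rat_vs.dependent_zero by metis
    then have c0: "c \<noteq> 0" using ci by auto
    have A: "z ^ j * c \<in> ?A" if "j < e" for j using that ci by blast
    show "rat_vs.representation ?A (z * a) a = 0"
    proof (cases "Suc i < e")
      case True
      have eq: "z * a = z ^ Suc i * c" using ci by simp
      have "z ^ Suc i * c \<noteq> a" using zi[of "Suc i" i] c0 ci by auto
      then show ?thesis unfolding eq using rat_vs.representation_basis[OF C(3) A[OF True]] by (simp del: power_Suc)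
    next
      case False
      with ci have ie: "e = Suc i" by simp
      then have "z * a = of_rat B * (z ^ 0 * c)" using B ci by (simp add: mult_ac)
      moreover have "z ^ 0 * c \<noteq> a" using zi[of 0 i] c0 ci ie e2 by auto
      ultimately show ?thesis
        using rat_vs.representation_basis[OF C(3) A[OF e(1)]] rat_vs.representation_scale[OF C(3) rat_vs.span_base[OF A[OF e(1)]]]
        by simp
    qed
  qed
  finally show ?thesis .
qed


text \<open>Divide the relation by \<open>x k\<close> and take traces of multiplication operators on the finite-dimensional
  space spanned by the monomials in the \<open>x i\<close>: only the term with index \<open>k\<close> survives.\<close>

theorem radicals_linearly_independent:
  fixes x :: "'i \<Rightarrow> real" and c :: "'i \<Rightarrow> rat"
  assumes I: "finite I" and N: "0 < N" and pos: "\<And>i. i \<in> I \<Longrightarrow> 0 < x i"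
    and rad: "\<And>i. i \<in> I \<Longrightarrow> x i ^ N \<in> \<rat>"
    and irr: "\<And>i j. i \<in> I \<Longrightarrow> j \<in> I \<Longrightarrow> i \<noteq> j \<Longrightarrow> x i / x j \<notin> \<rat>"
    and rel: "(\<Sum>i\<in>I. of_rat (c i) * x i) = 0" and k: "k \<in> I"
  shows "c k = 0"
proof -
  \<comment> \<open>Exponents below \<open>N\<close> suffice since \<open>x i ^ N\<close> is
    rational: multiplying by \<open>x j\<close> either raises an exponent or resets it to 0 at the
    price of a rational factor.\<close>
  define E where "E = I \<rightarrow>\<^sub>E {..<N}"
  define S where "S = (\<lambda>e. \<Prod>i\<in>I. x i ^ e i) ` E"
  define V where "V = rat_vs.span S"
  have finS: "finite S" unfolding S_def E_def by (intro finite_imageI finite_PiE I) auto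
  obtain D where D: "D \<subseteq> S" "rat_vs.independent D" "S \<subseteq> rat_vs.span D"
    using rat_vs.maximal_independent_subset by metis
  have VD: "V = rat_vs.span D" unfolding V_def
    using D by (metis rat_vs.span_mono rat_vs.span_span subset_antisym)
  have finD: "finite D" using D finS finite_subset by blast
  have gen: "x j * s \<in> V" if j: "j \<in> I" and s: "s \<in> S" for j s
  proof -
    obtain e where e: "e \<in> E" "s = (\<Prod>i\<in>I. x i ^ e i)" using s S_def by auto
    have split: "(\<Prod>i\<in>I. x i ^ f i) = x j ^ f j * (\<Prod>i\<in>I - {j}. x i ^ f i)" for f :: "'i \<Rightarrow> nat"
      using I j by (simp add: prod.remove)
    show ?thesis
    proof (cases "Suc (e j) < N")
      case True
      have "x j * s = (\<Prod>i\<in>I. x i ^ (e(j := Suc (e j))) i)"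
        unfolding e split by (simp add: mult_ac)
      moreover have "e(j := Suc (e j)) \<in> E" using e j True unfolding E_def by auto
      ultimately have "x j * s \<in> S" unfolding S_def by blast
      then show ?thesis unfolding V_def by (rule rat_vs.span_base)
    next
      case False
      moreover have "e j < N" using e j unfolding E_def by auto
      ultimately have eN: "Suc (e j) = N" by simp
      obtain r where r: "x j ^ N = of_rat r" using rad[OF j] by (auto elim: Rats_cases)
      have "x j * s = x j ^ Suc (e j) * (\<Prod>i\<in>I. x i ^ (e(j := 0)) i)"
        unfolding e split by (simp add: mult_ac)
      then have "x j * s = of_rat r * (\<Prod>i\<in>I. x i ^ (e(j := 0)) i)" unfolding eN r .
      moreover have "e(j := 0) \<in> E" using e j N unfolding E_def by auto
      then have "(\<Prod>i\<in>I. x i ^ (e(j := 0)) i) \<in> S" unfolding S_def by (rule imageI)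
      ultimately show ?thesis unfolding V_def by (simp only: rat_vs.span_base rat_vs.span_scale)
    qed
  qed
  have cl: "x j * v \<in> V" if j: "j \<in> I" and v: "v \<in> V" for j v
    using v unfolding V_def
  proof (induction rule: rat_vs.span_induct_alt)
    case base
    then show ?case by (simp add: rat_vs.span_zero)
  next
    case (step q u y)
    have "x j * (of_rat q * u + y) = of_rat q * (x j * u) + x j * y" by (simp add: algebra_simps)
    then show ?case using step gen[OF j step(1)] unfolding V_def
      by (simp only: rat_vs.span_add rat_vs.span_scale)
  qed
  have clp: "x j ^ n * v \<in> V" if "j \<in> I" "v \<in> V" for j n v
    using that cl by (induction n) (auto simp: mult.assoc)
  \<comment> \<open>Division by \<open>x k\<close> stays inside \<open>V\<close>: up to a rational
    factor, \<open>1 / x k\<close> is \<open>x k ^ (N - 1)\<close>.\<close>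
  have clz: "x i / x k * v \<in> V" if i: "i \<in> I" and v: "v \<in> V" for i v
  proof -
    obtain r where r: "x k ^ N = of_rat r" using rad[OF k] by (auto elim: Rats_cases)
    have "x i / x k = of_rat (1 / r) * (x i * x k ^ (N - 1))"
    proof -
      have "x k * x k ^ (N - 1) = of_rat r" using r N by (metis power_minus_mult mult.commute)
      moreover have "x k \<noteq> 0" using pos[OF k] by simp
      ultimately show ?thesis using pos[OF k] by (auto simp: of_rat_divide field_simps)
    qed
    then have "x i / x k * v = of_rat (1 / r) * (x i * (x k ^ (N - 1) * v))" by simp
    then show ?thesis using cl[OF i clp[OF k v, of "N - 1"]] unfolding V_def by (simp only: rat_vs.span_scale)
  qed
  have tr: "mult_trace D (x i / x k) = (if i = k then of_nat (card D) else 0)" if i: "i \<in> I" for i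
  proof (cases "i = k")
    case True
    then show ?thesis using pos[OF k] mult_trace_1[OF D(2)] by simp
  next
    case False
    have "mult_trace D (x i / x k) = 0"
      by (rule mult_trace_irrational_radical[where N = N])
        (use finD D(2) clz[OF i] VD pos[OF i] pos[OF k] irr[OF i k False] N rad[OF i] rad[OF k] in
          \<open>auto simp: power_divide\<close>)
    then show ?thesis using False by simp
  qed
  have "(\<Sum>i\<in>I. of_rat (c i) * (x i / x k)) = 0"
    using rel by (simp flip: sum_divide_distrib)
  then have "0 = mult_trace D (\<Sum>i\<in>I. of_rat (c i) * (x i / x k))"
    using finD by (simp add: mult_trace_def rat_vs.representation_zero)
  also have "\<dots> = (\<Sum>i\<in>I. c i * mult_trace D (x i / x k))"
    by (rule mult_trace_sum[OF finD D(2)]) (use clz VD rat_vs.span_base in auto)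
  also have "\<dots> = (\<Sum>i\<in>I. if i = k then c k * of_nat (card D) else 0)"
    by (rule sum.cong) (auto simp: tr)
  also have "\<dots> = c k * of_nat (card D)" using I k by simp
  finally have "c k * of_nat (card D) = 0" by simp
  \<comment> \<open>Needed to cancel \<open>card D\<close>: the monomial 1 lies in \<open>S\<close>,
    so the span of \<open>D\<close> is not zero.\<close>
  moreover have "D \<noteq> {}"
  proof
    assume "D = {}"
    moreover have "(\<Prod>i\<in>I. x i ^ (\<lambda>i\<in>I. 0) i) \<in> S" unfolding S_def E_def using N by (intro imageI) auto
    moreover have "(\<Prod>i\<in>I. x i ^ (\<lambda>i\<in>I. 0) i) = 1" by (intro prod.neutral) auto
    ultimately show False using D(3) by auto
  qed
  ultimately show ?thesis using finD by simp
qed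

section \<open>Approximate cocycles with prescribed increments\<close>

text \<open>A face of a cube of side \<open>R\<close> holds the proportion \<open>1 / R\<close> of
  its points; this is the boundary estimate for the boxes below. The multiplied form stays within
  the natural numbers.\<close>

lemma card_PiE_fix_coordinate:
  assumes F: "finite F" "s \<in> F" and v: "v < (R::nat)"
  shows "R * card {k \<in> F \<rightarrow>\<^sub>E {..<R}. k s = v} = card (F \<rightarrow>\<^sub>E {..<R})"
proof -
  have "{k \<in> F \<rightarrow>\<^sub>E {..<R}. k s = v} = (\<Pi>\<^sub>E t\<in>F. if t = s then {v} else {..<R})"
  proof (intro set_eqI iffI)
    fix k assume k: "k \<in> {k \<in> F \<rightarrow>\<^sub>E {..<R}. k s = v}"
    then show "k \<in> (\<Pi>\<^sub>E t\<in>F. if t = s then {v} else {..<R})" by (auto simp: PiE_iff)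
  next
    fix k assume k: "k \<in> (\<Pi>\<^sub>E t\<in>F. if t = s then {v} else {..<R})"
    then show "k \<in> {k \<in> F \<rightarrow>\<^sub>E {..<R}. k s = v}"
      using F v by (auto simp: PiE_iff split: if_splits)
  qed
  then have "card {k \<in> F \<rightarrow>\<^sub>E {..<R}. k s = v} = (\<Prod>t\<in>F. if t = s then 1 else R)"
    using F by (simp add: card_PiE if_distrib cong: if_cong)
  also have "\<dots> = R ^ card (F - {s})"
    using F by (subst prod.remove[of _ s]) (auto intro!: prod.cong)
  finally have "R * card {k \<in> F \<rightarrow>\<^sub>E {..<R}. k s = v} = R ^ Suc (card (F - {s}))" by simp
  then show ?thesis unfolding card_Suc_Diff1[OF F] using F by (simp add: card_PiE)
qed

text \<open>Integer coefficients lose nothing against rational ones, since denominators can be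
  cleared. Being a property of a set, it does not see repetitions, so injectivity of the enumeration
  is required separately.\<close>

definition int_independent :: "real set \<Rightarrow> bool" where
  "int_independent S \<longleftrightarrow>
    (\<forall>F k. finite F \<longrightarrow> F \<subseteq> S \<longrightarrow> (\<Sum>s\<in>F. of_int (k s) * s) = 0 \<longrightarrow> (\<forall>s\<in>F. k s = (0::int)))"

text \<open>The only property of the times that the dynamical part uses. \<open>K\<close> may depend
  on \<open>\<delta>\<close> but not on \<open>N\<close>; the classes \<open>Q k\<close> may overlap
  and may be infinite.\<close>

definition indep_dense :: "(nat \<Rightarrow> real) \<Rightarrow> bool" where
  "indep_dense s \<longleftrightarrow> (\<forall>\<delta>>0. \<exists>(K::nat) Q n0.
     (\<forall>k<K. inj_on s (Q k) \<and> int_independent (s ` Q k)) \<and>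
     (\<forall>N\<ge>n0. real (card {n \<in> {1..N}. \<forall>k<K. n \<notin> Q k}) \<le> \<delta> * real N))"

lemma int_independent_subset: "int_independent S \<Longrightarrow> S' \<subseteq> S \<Longrightarrow> int_independent S'"
  unfolding int_independent_def by (meson order_trans)

text \<open>Independence makes the sums with coefficients \<open>k s < R\<close> pairwise distinct,
  so \<open>U\<close> is a faithful copy of a cube and \<open>h\<close>, the additive extension of
  \<open>c\<close>, is well defined on it. Translation by \<open>s\<close> shifts one coordinate, so
  it gains and loses at most a single face.\<close>

lemma exists_Folner_box:
  fixes F :: "real set" and c :: "real \<Rightarrow> int"
  assumes F: "finite F" and R: "0 < R" and indep: "int_independent F"
  obtains U h where "finite U" "U \<noteq> {}"
    "\<And>s. s \<in> F \<Longrightarrow> R * card (U - (\<lambda>u. u + s) ` U) \<le> card U"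
    "\<And>s. s \<in> F \<Longrightarrow> R * card ((\<lambda>u. u + s) ` U - U) \<le> card U"
    "\<And>s u. s \<in> F \<Longrightarrow> u \<in> U \<Longrightarrow> u + s \<in> U \<Longrightarrow> h (u + s) = h u + c s"
proof -
  define G where "G = F \<rightarrow>\<^sub>E {..<R}"
  define u where "u k = (\<Sum>s\<in>F. real (k s) * s)" for k :: "real \<Rightarrow> nat"
  have finG: "finite G" unfolding G_def using F by (intro finite_PiE) auto
  have inj: "k s = k' s" if "u k = u k'" "s \<in> F" for k k' s
  proof -
    have "(\<Sum>s\<in>F. of_int (int (k s) - int (k' s)) * s) = u k - u k'"
      unfolding u_def by (simp add: sum_subtractf algebra_simps)
    then show ?thesis
      using indep[unfolded int_independent_def, rule_format, of F "\<lambda>s. int (k s) - int (k' s)" s] F that by simp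
  qed
  have injG: "inj_on u G"
    unfolding G_def by (intro inj_onI PiE_ext) (auto intro: inj)
  have shift: "u (k(s := Suc (k s))) = u k + s" if "s \<in> F" for k s
    unfolding u_def by (simp add: sum.remove[OF F that] algebra_simps)
  define h where "h r = (\<Sum>s\<in>F. int (the_inv_into G u r s) * c s)" for r
  have hu: "h (u k) = (\<Sum>s\<in>F. int (k s) * c s)" if "k \<in> G" for k
    unfolding h_def using the_inv_into_f_f[OF injG that] by simp
  show thesis
  proof (rule that[of "u ` G" h])
    show "finite (u ` G)" using finG by simp
    show "u ` G \<noteq> {}" unfolding G_def using R by (auto simp: PiE_eq_empty_iff)
  next
    fix s assume s: "s \<in> F"
    have "u ` G - (\<lambda>u. u + s) ` u ` G \<subseteq> u ` {k \<in> G. k s = 0}"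
    proof
      fix r assume r: "r \<in> u ` G - (\<lambda>u. u + s) ` u ` G"
      then obtain k where k: "k \<in> G" "r = u k" by auto
      have "k s = 0"
      proof (rule ccontr)
        assume "k s \<noteq> 0"
        then have "(k(s := k s - 1)) (s := Suc ((k(s := k s - 1)) s)) = k" by auto
        then have "r = u (k(s := k s - 1)) + s" using shift[OF s, of "k(s := k s - 1)"] k by simp
        moreover have "k(s := k s - 1) \<in> G" using k s unfolding G_def by (auto simp: PiE_iff extensional_def less_imp_diff_less)
        ultimately show False using r by blast
      qed
      then show "r \<in> u ` {k \<in> G. k s = 0}" using k by auto
    qed
    then have "card (u ` G - (\<lambda>u. u + s) ` u ` G) \<le> card (u ` {k \<in> G. k s = 0})"
      using finG by (intro card_mono) auto
    also have "\<dots> \<le> card {k \<in> G. k s = 0}" using finG by (intro card_image_le) auto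
    finally have "R * card (u ` G - (\<lambda>u. u + s) ` u ` G) \<le> R * card {k \<in> G. k s = 0}" by simp
    also have "\<dots> = card G" unfolding G_def using card_PiE_fix_coordinate[OF F s R] .
    finally show "R * card (u ` G - (\<lambda>u. u + s) ` u ` G) \<le> card (u ` G)" using injG by (simp add: card_image)
    have "(\<lambda>u. u + s) ` u ` G - u ` G \<subseteq> (\<lambda>k. u k + s) ` {k \<in> G. k s = R - 1}"
    proof
      fix r assume r: "r \<in> (\<lambda>u. u + s) ` u ` G - u ` G"
      then obtain k where k: "k \<in> G" "r = u k + s" by auto
      have "k s = R - 1"
      proof (rule ccontr)
        assume "k s \<noteq> R - 1"
        moreover have "k s < R" using k s unfolding G_def by auto
        ultimately have "k(s := Suc (k s)) \<in> G" using k s unfolding G_def by (auto simp: PiE_iff extensional_def)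
        moreover have "r = u (k(s := Suc (k s)))" using shift[OF s] k by simp
        ultimately show False using r by blast
      qed
      then show "r \<in> (\<lambda>k. u k + s) ` {k \<in> G. k s = R - 1}" using k by auto
    qed
    then have "card ((\<lambda>u. u + s) ` u ` G - u ` G) \<le> card ((\<lambda>k. u k + s) ` {k \<in> G. k s = R - 1})"
      using finG by (intro card_mono) auto
    also have "\<dots> \<le> card {k \<in> G. k s = R - 1}" using finG by (intro card_image_le) auto
    finally have "R * card ((\<lambda>u. u + s) ` u ` G - u ` G) \<le> R * card {k \<in> G. k s = R - 1}" by simp
    also have "\<dots> = card G" unfolding G_def using card_PiE_fix_coordinate[OF F s, of "R - 1" R] R by simp
    finally show "R * card ((\<lambda>u. u + s) ` u ` G - u ` G) \<le> card (u ` G)" using injG by (simp add: card_image)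
  next
    fix s r assume s: "s \<in> F" and r: "r \<in> u ` G" "r + s \<in> u ` G"
    from r obtain k k' where k: "k \<in> G" "r = u k" and k': "k' \<in> G" "r + s = u k'" by auto
    have "u k' = u (k(s := Suc (k s)))" using shift[OF s] k k' by simp
    then have eq: "k' t = (k(s := Suc (k s))) t" if "t \<in> F" for t using inj that by blast
    have "h (r + s) = (\<Sum>t\<in>F. int ((k(s := Suc (k s))) t) * c t)"
      unfolding k'(2) hu[OF k'(1)] by (intro sum.cong refl) (simp only: eq)
    also have "\<dots> = h r + c s"
      unfolding k(2) hu[OF k(1)] by (simp add: sum.remove[OF F s] algebra_simps)
    finally show "h (r + s) = h r + c s" .
  qed
qed

text \<open>Composition with the transposition of \<open>d\<close> and \<open>d'\<close> carries the
  permutations whose minimum over \<open>D\<close> is at \<open>d\<close> to those with minimum at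
  \<open>d'\<close>. So under a uniformly random labelling every point of a nonempty
  \<open>D\<close> is equally likely to be least, and the minimum falls in \<open>C\<close> with
  probability \<open>card C / card D\<close>.\<close>

lemma card_permutes_argmin:
  fixes A :: "nat set"
  assumes A: "finite A" and D: "D \<subseteq> A" and C: "C \<subseteq> D"
  shows "card {\<pi>. \<pi> permutes A \<and> (\<exists>d\<in>C. \<forall>d'\<in>D. \<pi> d \<le> \<pi> d')} * card D = card C * fact (card A)"
proof (cases "D = {}")
  case True
  then show ?thesis using C by auto
next
  case False
  define P where "P d = {\<pi>. \<pi> permutes A \<and> (\<forall>d'\<in>D. \<pi> d \<le> \<pi> d')}" for d
  have finD: "finite D" using D A by (rule finite_subset)
  have fin: "finite {\<pi>. \<pi> permutes A}" using A by (rule finite_permutations)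
  then have finP: "finite (P d)" for d unfolding P_def by (rule rev_finite_subset) auto
  have disj: "P d \<inter> P d' = {}" if "d \<noteq> d'" "d \<in> D" "d' \<in> D" for d d'
  proof -
    have False if p: "\<pi> \<in> P d" "\<pi> \<in> P d'" for \<pi>
    proof -
      have "\<pi> d \<le> \<pi> d'" "\<pi> d' \<le> \<pi> d" "\<pi> permutes A"
        using p \<open>d \<in> D\<close> \<open>d' \<in> D\<close> by (auto simp: P_def)
      then show False using permutes_inj[of \<pi> A] \<open>d \<noteq> d'\<close> by (simp add: inj_eq)
    qed
    then show ?thesis by auto
  qed
  have le: "card (P d) \<le> card (P d')" if d: "d \<in> D" "d' \<in> D" for d d'
  proof (rule card_inj_on_le)
    let ?t = "Transposition.transpose d d'"
    have tp: "?t permutes A" using d D by (intro permutes_swap_id) auto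
    have tD: "?t x \<in> D" if "x \<in> D" for x using d that by (auto simp: Transposition.transpose_def)
    show "inj_on (\<lambda>\<pi>. \<pi> \<circ> ?t) (P d)"
    proof (rule inj_onI)
      fix \<pi> \<rho> assume "\<pi> \<circ> ?t = \<rho> \<circ> ?t"
      then have "(\<pi> \<circ> ?t) \<circ> ?t = (\<rho> \<circ> ?t) \<circ> ?t" by simp
      then show "\<pi> = \<rho>" by (simp add: comp_assoc)
    qed
    show "(\<lambda>\<pi>. \<pi> \<circ> ?t) ` P d \<subseteq> P d'"
    proof
      fix \<rho> assume "\<rho> \<in> (\<lambda>\<pi>. \<pi> \<circ> ?t) ` P d"
      then obtain \<pi> where \<pi>: "\<pi> \<in> P d" "\<rho> = \<pi> \<circ> ?t" by auto
      then have "\<rho> permutes A" using permutes_compose[OF tp, of \<pi>] unfolding P_def by simp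
      moreover have "\<rho> d' \<le> \<rho> x" if "x \<in> D" for x
        using \<pi> tD[OF that] unfolding P_def by simp
      ultimately show "\<rho> \<in> P d'" unfolding P_def by simp
    qed
  qed (rule finP)
  obtain d0 where d0: "d0 \<in> D" using False by auto
  have eq: "card (P d) = card (P d0)" if "d \<in> D" for d using le[OF that d0] le[OF d0 that] by simp
  have U: "card (\<Union>d\<in>S. P d) = card S * card (P d0)" if "S \<subseteq> D" for S
  proof -
    have "finite S" using that finD by (rule finite_subset)
    then have "card (\<Union>d\<in>S. P d) = (\<Sum>d\<in>S. card (P d))"
      using that finP by (intro card_UN_disjoint ballI impI disj) auto
    also have "\<dots> = card S * card (P d0)" using eq that by (simp add: subset_iff)
    finally show ?thesis .
  qed
  have "(\<Union>d\<in>D. P d) = {\<pi>. \<pi> permutes A}"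
  proof (intro equalityI subsetI)
    fix \<pi> assume \<pi>: "\<pi> \<in> {\<pi>. \<pi> permutes A}"
    have "arg_min_on \<pi> D \<in> D" "\<forall>x\<in>D. \<pi> (arg_min_on \<pi> D) \<le> \<pi> x"
      using arg_min_if_finite[OF finD False, of \<pi>] by (auto simp: not_less)
    then show "\<pi> \<in> (\<Union>d\<in>D. P d)" using \<pi> by (intro UN_I[of "arg_min_on \<pi> D"]) (auto simp: P_def)
  qed (auto simp: P_def)
  then have tot: "card D * card (P d0) = fact (card A)" using U[of D] card_permutations[OF refl A] by simp
  have "{\<pi>. \<pi> permutes A \<and> (\<exists>d\<in>C. \<forall>d'\<in>D. \<pi> d \<le> \<pi> d')} = (\<Union>d\<in>C. P d)" unfolding P_def by auto
  then have "card {\<pi>. \<pi> permutes A \<and> (\<exists>d\<in>C. \<forall>d'\<in>D. \<pi> d \<le> \<pi> d')} * card D = card C * (card D * card (P d0))"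
    using U[OF C] by simp
  then show ?thesis using tot by simp
qed

text \<open>\<open>\<Psi>\<close> is arbitrary: the bound leaves finitely many tuples, so each level
  set is a finite union of sets where the tuple is constant. It serves for a \<open>\<Psi>\<close>
  built from \<open>arg_min_on\<close>; the restriction to \<open>U\<close> makes the tuple an
  element of a finite product.\<close>

lemma measurable_finite_tuple:
  fixes g :: "'u \<Rightarrow> 'a \<Rightarrow> nat" and \<Psi> :: "('u \<Rightarrow> nat) \<Rightarrow> int"
  assumes U: "finite U" and meas: "\<And>u. u \<in> U \<Longrightarrow> g u \<in> M \<rightarrow>\<^sub>M count_space UNIV"
    and bd: "\<And>u x. u \<in> U \<Longrightarrow> x \<in> space M \<Longrightarrow> g u x \<le> k"
  shows "(\<lambda>x. \<Psi> (\<lambda>u\<in>U. g u x)) \<in> M \<rightarrow>\<^sub>M count_space UNIV"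
proof (rule measurable_count_space_eq2_countable[THEN iffD2], intro conjI ballI)
  fix a :: int
  have "(\<lambda>x. \<Psi> (\<lambda>u\<in>U. g u x)) -` {a} \<inter> space M =
    (\<Union>t\<in>{t \<in> U \<rightarrow>\<^sub>E {..k}. \<Psi> t = a}. {x \<in> space M. \<forall>u\<in>U. g u x = t u})"
  proof (intro equalityI subsetI)
    fix x assume "x \<in> (\<lambda>x. \<Psi> (\<lambda>u\<in>U. g u x)) -` {a} \<inter> space M"
    then show "x \<in> (\<Union>t\<in>{t \<in> U \<rightarrow>\<^sub>E {..k}. \<Psi> t = a}. {x \<in> space M. \<forall>u\<in>U. g u x = t u})"
      using bd by (intro UN_I[of "\<lambda>u\<in>U. g u x"]) auto
  next
    fix x assume "x \<in> (\<Union>t\<in>{t \<in> U \<rightarrow>\<^sub>E {..k}. \<Psi> t = a}. {x \<in> space M. \<forall>u\<in>U. g u x = t u})"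
    then obtain t where t: "t \<in> U \<rightarrow>\<^sub>E {..k}" "\<Psi> t = a" "x \<in> space M" "\<forall>u\<in>U. g u x = t u" by auto
    then have "(\<lambda>u\<in>U. g u x) = t" by (intro PiE_ext[of _ U "\<lambda>_. UNIV" t]) auto
    then show "x \<in> (\<lambda>x. \<Psi> (\<lambda>u\<in>U. g u x)) -` {a} \<inter> space M" using t by auto
  qed
  also have "\<dots> \<in> sets M"
  proof (intro sets.finite_UN)
    show "finite {t \<in> U \<rightarrow>\<^sub>E {..k}. \<Psi> t = a}"
      by (rule rev_finite_subset[OF finite_PiE[of U "\<lambda>_. {..k}"]]) (use U in auto)
    fix t
    show "{x \<in> space M. \<forall>u\<in>U. g u x = t u} \<in> sets M"
    proof (rule sets.sets_Collect_finite_All[OF _ U])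
      fix u assume "u \<in> U"
      from measurable_sets[OF meas[OF this], of "{t u}"] show "{x \<in> space M. g u x = t u} \<in> sets M"
        by (simp add: vimage_def Int_def conj_commute)
    qed
  qed
  finally show "(\<lambda>x. \<Psi> (\<lambda>u\<in>U. g u x)) -` {a} \<inter> space M \<in> sets M" .
qed (auto intro: countableI_type)

section \<open>Separating orbit points by finite partitions\<close>

lemma (in lebesgue_prob_space) exists_injective_coordinate:
  "\<exists>f N. f \<in> borel_measurable M \<and> N \<in> null_sets M \<and> (\<forall>x. f x \<in> {0..1::real}) \<and> inj_on f (space M - N)"
proof -
  obtain Y where Y: "Y \<in> sets lebesgue" "Y \<subseteq> {0..1 :: real}" "isomorphic_mod_0 M (lebesgue_on Y)"
    using isomorphic_unit_interval_subset by auto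
  then obtain N N' f where N: "N \<in> null_sets M" "N' \<in> null_sets (lebesgue_on Y)"
    and bij: "bij_betw f (space (restrict_space M (space M - N))) (space (restrict_space (lebesgue_on Y) (space (lebesgue_on Y) - N')))"
    and f: "f \<in> restrict_space M (space M - N) \<rightarrow>\<^sub>M restrict_space (lebesgue_on Y) (space (lebesgue_on Y) - N')"
    unfolding isomorphic_mod_0_def Let_def by blast
  have sp: "space (restrict_space M (space M - N)) = space M - N" by (auto simp: space_restrict_space)
  have f1: "f \<in> restrict_space M (space M - N) \<rightarrow>\<^sub>M borel"
  proof -
    have "(\<lambda>x. x) \<in> lebesgue \<rightarrow>\<^sub>M (borel :: real measure)" by (simp add: measurable_completion)
    then have "(\<lambda>x. x) \<in> restrict_space (lebesgue_on Y) (space (lebesgue_on Y) - N') \<rightarrow>\<^sub>M (borel :: real measure)"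
      by (intro measurable_restrict_space1)
    from measurable_compose[OF f this] show ?thesis by simp
  qed
  \<comment> \<open>The value 0 on the null set keeps the range in the unit interval; injectivity is
    claimed only off that set.\<close>
  define g where "g x = (if x \<in> space M - N then f x else 0)" for x
  have "g \<in> borel_measurable M"
  proof -
    have "{x \<in> space M. x \<in> space M - N} = space M - N" by auto
    with f1 show ?thesis unfolding g_def
      by (subst measurable_If_restrict_space_iff) (use N in \<open>auto simp: Collect_conj_eq\<close>)
  qed
  moreover have "g x \<in> {0..1}" for x
  proof (cases "x \<in> space M - N")
    case True
    then have "f x \<in> Y" using bij_betwE[OF bij] sp by (auto simp: space_restrict_space)
    then show ?thesis using Y True by (auto simp: g_def)
  qed (auto simp: g_def)
  moreover have "inj_on g (space M - N)"
    using bij unfolding sp bij_betw_def by (auto simp: g_def inj_on_def)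
  ultimately show ?thesis using N by blast
qed

context aperiodic_dynamical_system begin

lemma flow_measure:
  assumes "A \<in> sets M"
  shows "measure M (T t -` A \<inter> space M) = measure M A"
  using measure_preserving[OF assms] by (simp add: measure_def)

lemma AE_flow_distinct:
  assumes "finite W"
  shows "AE x in M. inj_on (\<lambda>u. T u x) W"
proof -
  have "AE x in M. x \<notin> {x \<in> space M. \<exists>s t. t \<noteq> s \<and> T t x = T s x}"
    using aperiodic by (rule AE_not_in)
  then show ?thesis by (rule AE_mp) (auto intro!: AE_I2 inj_onI)
qed

lemma AE_flow_notin_null:
  assumes "N \<in> null_sets M" "finite W"
  shows "AE x in M. \<forall>u\<in>W. T u x \<notin> N"
proof -
  have "AE x in M. T u x \<notin> N" for u
  proof -
    have "T u -` N \<inter> space M \<in> sets M" using transformation_measurable assms(1) by (auto intro: measurable_sets)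
    moreover have "emeasure M (T u -` N \<inter> space M) = 0"
      using measure_preserving[of N u] assms(1) by (simp add: null_setsD1 null_setsD2)
    ultimately have "T u -` N \<inter> space M \<in> null_sets M" by auto
    from AE_not_in[OF this] show ?thesis by (rule AE_mp) (auto intro!: AE_I2)
  qed
  then show ?thesis using assms(2) by (simp add: AE_finite_all)
qed

text \<open>The cells come from rounding down an injective coordinate to multiples of
  \<open>1 / k\<close>. Aperiodicity keeps the points \<open>T u x\<close> apart for almost every
  \<open>x\<close>, so their coordinates differ and every large \<open>k\<close> separates them;
  dominated convergence turns this into a bad set of small measure for one \<open>k\<close>.\<close>

lemma exists_separating_partition:
  assumes W: "finite W" and \<eta>: "0 < \<eta>"
  obtains a :: "'a \<Rightarrow> nat" and k B where "a \<in> M \<rightarrow>\<^sub>M count_space UNIV" "\<And>x. a x \<le> k"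
    "B \<in> sets M" "measure M B \<le> \<eta>" "\<And>x. x \<in> space M - B \<Longrightarrow> inj_on (\<lambda>u. a (T u x)) W"
proof -
  obtain f N where f [measurable]: "f \<in> borel_measurable M" and N: "N \<in> null_sets M"
    and f01': "\<forall>x. f x \<in> {0..1::real}" and inj: "inj_on f (space M - N)"
    using exists_injective_coordinate by metis
  have f01: "f x \<in> {0..1}" for x using f01' by simp
  note transformation_measurable [measurable]
  define a where "a k x = nat \<lfloor>f x * real k\<rfloor>" for k x
  have a_meas [measurable]: "a k \<in> M \<rightarrow>\<^sub>M count_space UNIV" for k unfolding a_def by measurable
  have a_le: "a k x \<le> k" for k x
  proof -
    have "f x * real k \<le> real k" using f01[of x] by (simp add: mult_left_le_one_le)
    then have "\<lfloor>f x * real k\<rfloor> \<le> int k" by linarith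
    then show ?thesis unfolding a_def by linarith
  qed
  define B where "B k = {x \<in> space M. \<exists>u\<in>W. \<exists>v\<in>W - {u}. a k (T u x) = a k (T v x)}" for k
  have B_meas: "B k \<in> sets M" for k
  proof -
    have "B k = (\<Union>u\<in>W. \<Union>v\<in>W - {u}. {x \<in> space M. a k (T u x) = a k (T v x)})"
      unfolding B_def by auto
    moreover have "{x \<in> space M. a k (T u x) = a k (T v x)} \<in> sets M" for u v
    proof -
      have "(\<lambda>x. real (a k (T w x))) \<in> borel_measurable M" for w by measurable
      from borel_measurable_eq[OF this[of u] this[of v]] show ?thesis by simp
    qed
    ultimately show ?thesis using W by (simp add: sets.finite_UN)
  qed
  have conv: "AE x in M. (\<lambda>k. indicator (B k) x :: real) \<longlonglongrightarrow> 0"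
  proof -
    have "AE x in M. x \<in> space M \<and> inj_on (\<lambda>u. T u x) W \<and> (\<forall>u\<in>W. T u x \<notin> N)"
      using AE_space AE_flow_distinct[OF W] AE_flow_notin_null[OF N W] by eventually_elim auto
    then show ?thesis
    proof (rule AE_mp, intro AE_I2 impI)
      fix x assume x: "x \<in> space M \<and> inj_on (\<lambda>u. T u x) W \<and> (\<forall>u\<in>W. T u x \<notin> N)"
      have "eventually (\<lambda>k. a k (T u x) \<noteq> a k (T v x)) sequentially" if uv: "u \<in> W" "v \<in> W" "u \<noteq> v" for u v
      proof -
        have "T u x \<in> space M - N" "T v x \<in> space M - N" using x uv measurable_space[OF transformation_measurable] by auto
        moreover have "T u x \<noteq> T v x" using x uv by (auto dest: inj_onD)
        ultimately have ne: "f (T u x) \<noteq> f (T v x)" using inj by (auto dest: inj_onD)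
        define d where "d = \<bar>f (T u x) - f (T v x)\<bar>"
        have d: "d > 0" using ne d_def by simp
        obtain k0 :: nat where k0: "1 / d < real k0" using reals_Archimedean2 by blast
        show ?thesis
        proof (rule eventually_sequentiallyI[of k0], rule notI)
          fix k assume k: "k0 \<le> k" and eq: "a k (T u x) = a k (T v x)"
          have "0 \<le> f y * real k" for y using f01[of y] by simp
          then have "\<lfloor>f (T u x) * real k\<rfloor> = \<lfloor>f (T v x) * real k\<rfloor>"
            using eq unfolding a_def by (subst (asm) eq_nat_nat_iff) auto
          then have "\<bar>f (T u x) * real k - f (T v x) * real k\<bar> < 1" by linarith
          then have "d * real k < 1" unfolding d_def by (simp add: abs_mult flip: left_diff_distrib)
          moreover have "1 < d * real k0" using k0 d by (simp add: field_simps)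
          moreover have "d * real k0 \<le> d * real k" using k d by simp
          ultimately show False by linarith
        qed
      qed
      then have "eventually (\<lambda>k. \<forall>u\<in>W. \<forall>v\<in>W. u \<noteq> v \<longrightarrow> a k (T u x) \<noteq> a k (T v x)) sequentially"
        using W by (simp add: eventually_ball_finite_distrib)
      then have "eventually (\<lambda>k. indicator (B k) x = (0::real)) sequentially"
        by eventually_elim (auto simp: B_def)
      then show "(\<lambda>k. indicator (B k) x :: real) \<longlonglongrightarrow> 0" by (rule tendsto_eventually)
    qed
  qed
  have "(\<lambda>k. LINT x|M. indicator (B k) x) \<longlonglongrightarrow> (LINT x|M. (0::real))"
    by (rule integral_dominated_convergence[where w = "\<lambda>_. 1"])
      (use B_meas conv in \<open>auto simp: indicator_def\<close>)
  moreover have "(LINT x|M. indicator (B k) x) = measure M (B k)" for k using B_meas by simp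
  ultimately have "(\<lambda>k. measure M (B k)) \<longlonglongrightarrow> 0" by simp
  from order_tendstoD(2)[OF this \<eta>] obtain k where "measure M (B k) < \<eta>"
    by (auto simp: eventually_sequentially)
  moreover have "inj_on (\<lambda>u. a k (T u x)) W" if "x \<in> space M - B k" for x
    using that unfolding B_def inj_on_def by auto
  ultimately show thesis by (intro that[OF a_meas[of k] a_le[of k] B_meas[of k]]) auto
qed

text \<open>A substitute for a Rokhlin lemma. Split the space so finely that the points \<open>T u x\<close>, \<open>u\<close> in a box
  \<open>U\<close> of times, mostly lie in distinct cells, and label the cells by a random permutation. The point of
  \<open>U\<close> of smallest label serves as an origin for \<open>x\<close>; by exchangeability the origins of \<open>x\<close> and \<open>T s x\<close>
  are the same point of the orbit with probability close to 1, and averaging selects one permutation.\<close>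

theorem exists_approx_equivariant:
  fixes F :: "real set" and c :: "real \<Rightarrow> int"
  assumes F: "finite F" and \<eta>: "0 < \<eta>" and indep: "int_independent F"
  obtains \<phi> :: "'a \<Rightarrow> int" and B where "\<phi> \<in> M \<rightarrow>\<^sub>M count_space UNIV" "B \<in> sets M" "measure M B \<le> \<eta>"
    "\<And>x s. x \<in> space M - B \<Longrightarrow> s \<in> F \<Longrightarrow> \<phi> (T s x) = \<phi> x + c s"
proof -
  \<comment> \<open>Each \<open>s \<in> F\<close> will fail with probability at most
    \<open>2 / R\<close>, the factor 2 counting both halves of a symmetric difference. This
    \<open>R\<close> spends \<open>\<eta> / 2\<close> on these failures and leaves
    \<open>\<eta> / 2\<close> for the points that the partition does not separate.\<close>
  obtain R :: nat where R0: "4 * card F / \<eta> < real R" using reals_Archimedean2 by blast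
  have R: "0 < R"
  proof -
    have "0 \<le> 4 * card F / \<eta>" using \<eta> by simp
    then show ?thesis using R0 by (cases R) auto
  qed
  have RF: "2 * real (card F) / real R \<le> \<eta> / 2" using R0 \<eta> R by (simp add: field_simps)
  obtain U h where U: "finite U" "U \<noteq> {}"
    and Fol1: "\<And>s. s \<in> F \<Longrightarrow> R * card (U - (\<lambda>u. u + s) ` U) \<le> card U"
    and Fol2: "\<And>s. s \<in> F \<Longrightarrow> R * card ((\<lambda>u. u + s) ` U - U) \<le> card U"
    and h: "\<And>s u. s \<in> F \<Longrightarrow> u \<in> U \<Longrightarrow> u + s \<in> U \<Longrightarrow> h (u + s) = h u + c s"
    by (rule exists_Folner_box[where c = c, OF F R indep]) (rule that)
  \<comment> \<open>The origin of \<open>T s x\<close> is sought among the points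
    \<open>T (u + s) x\<close>, so the partition must separate the translates of \<open>U\<close> as
    well.\<close>
  define W where "W = U \<union> (\<Union>s\<in>F. (\<lambda>u. u + s) ` U)"
  have finW: "finite W" unfolding W_def using U F by auto
  obtain a :: "'a \<Rightarrow> nat" and k B0 where a: "a \<in> M \<rightarrow>\<^sub>M count_space UNIV" "\<And>x. a x \<le> k"
    and B0: "B0 \<in> sets M" "measure M B0 \<le> \<eta> / 2" "\<And>x. x \<in> space M - B0 \<Longrightarrow> inj_on (\<lambda>u. a (T u x)) W"
    by (rule exists_separating_partition[OF finW half_gt_zero[OF \<eta>]]) (rule that)
  note a(1) [measurable] transformation_measurable [measurable]
  define A where "A = {..k}"
  have aA: "a x \<in> A" for x using a(2) A_def by auto
  have finA: "finite A" unfolding A_def by simp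
  \<comment> \<open>The sign: if \<open>x\<close> has origin \<open>v + s\<close>, the same orbit
    point seen from \<open>T s x\<close> is at \<open>v\<close>, and
    \<open>h (v + s) = h v + c s\<close> gives \<open>\<phi>\<close> the increment
    \<open>+ c s\<close>.\<close>
  define \<phi> where "\<phi> \<pi> x = - h (arg_min_on (\<lambda>u\<in>U. \<pi> (a (T u x))) U)" for \<pi> :: "nat \<Rightarrow> nat" and x
  have \<phi>_meas [measurable]: "\<phi> \<pi> \<in> M \<rightarrow>\<^sub>M count_space UNIV" if \<pi>: "\<pi> permutes A" for \<pi>
    unfolding \<phi>_def
  proof (rule measurable_finite_tuple[OF U(1), where k = k])
    show "(\<lambda>x. \<pi> (a (T u x))) \<in> M \<rightarrow>\<^sub>M count_space UNIV" for u by measurable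
    show "\<pi> (a (T u x)) \<le> k" for u x using permutes_in_image[OF \<pi>, of "a (T u x)"] aA A_def by auto
  qed
  have argmin: "arg_min_on (\<lambda>u\<in>U. \<pi> (a (T u x))) U = w"
    if \<pi>: "\<pi> permutes A" and w: "w \<in> U" and inj: "inj_on (\<lambda>u. a (T u x)) U"
      and min: "\<And>u. u \<in> U \<Longrightarrow> \<pi> (a (T w x)) \<le> \<pi> (a (T u x))" for \<pi> x w
  proof -
    let ?m = "arg_min_on (\<lambda>u\<in>U. \<pi> (a (T u x))) U"
    have m: "?m \<in> U" "\<not> (\<exists>u\<in>U. (\<lambda>u\<in>U. \<pi> (a (T u x))) u < (\<lambda>u\<in>U. \<pi> (a (T u x))) ?m)"
      using arg_min_if_finite[OF U] by blast+
    then have "\<pi> (a (T ?m x)) \<le> \<pi> (a (T w x))" using w by auto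
    with min[OF m(1)] have "\<pi> (a (T ?m x)) = \<pi> (a (T w x))" by simp
    then have "a (T ?m x) = a (T w x)" using permutes_inj[OF \<pi>] by (simp add: inj_eq)
    then show ?thesis using inj m(1) w by (auto dest: inj_onD)
  qed
  define bad where "bad s \<pi> = {x \<in> space M - B0. \<phi> \<pi> (T s x) \<noteq> \<phi> \<pi> x + c s}" for s \<pi>
  have bad_meas: "bad s \<pi> \<in> sets M" if "\<pi> permutes A" for s \<pi>
  proof -
    note \<phi>_meas[OF that, measurable] B0(1) [measurable]
    have "bad s \<pi> = {x \<in> space M. x \<notin> B0 \<and> \<phi> \<pi> (T s x) \<noteq> \<phi> \<pi> x + c s}" unfolding bad_def by auto
    also have "\<dots> \<in> sets M" by measurable
    finally show ?thesis .
  qed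
  have count: "real (card {\<pi>. \<pi> permutes A \<and> x \<in> bad s \<pi>}) \<le> 2 / R * fact (card A)"
    if s: "s \<in> F" and x: "x \<in> space M" for s x
  proof (cases "x \<in> B0")
    case True
    then have "{\<pi>. \<pi> permutes A \<and> x \<in> bad s \<pi>} = {}" unfolding bad_def by blast
    then show ?thesis by (simp only: card.empty) simp
  next
    case False
    with x have inj: "inj_on (\<lambda>u. a (T u x)) W" by (intro B0(3) DiffI)
    let ?S = "(\<lambda>u. u + s) ` U" and ?g = "\<lambda>u. a (T u x)"
    let ?D = "?g ` (U \<union> ?S)" and ?C = "?g ` ((U - ?S) \<union> (?S - U))"
    have sW: "U \<union> ?S \<subseteq> W" unfolding W_def using s by (intro Un_mono order_refl UN_upper)
    \<comment> \<open>If the least label over \<open>U \<union> ?S\<close> occurs in the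
      intersection, it selects the same orbit point for \<open>x\<close> and for
      \<open>T s x\<close>, and the increment is right. A bad labelling therefore has its minimum in
      the symmetric difference.\<close>
    have "{\<pi>. \<pi> permutes A \<and> x \<in> bad s \<pi>} \<subseteq> {\<pi>. \<pi> permutes A \<and> (\<exists>d\<in>?C. \<forall>d'\<in>?D. \<pi> d \<le> \<pi> d')}"
    proof
      fix \<pi> assume "\<pi> \<in> {\<pi>. \<pi> permutes A \<and> x \<in> bad s \<pi>}"
      then have \<pi>: "\<pi> permutes A" and bx: "\<phi> \<pi> (T s x) \<noteq> \<phi> \<pi> x + c s" unfolding bad_def by auto
      define w where "w = arg_min_on (\<lambda>u. \<pi> (?g u)) (U \<union> ?S)"
      have fS: "finite (U \<union> ?S)" "U \<union> ?S \<noteq> {}" using U by auto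
      have w: "w \<in> U \<union> ?S" "\<And>u. u \<in> U \<union> ?S \<Longrightarrow> \<pi> (?g w) \<le> \<pi> (?g u)"
        using arg_min_if_finite[OF fS, of "\<lambda>u. \<pi> (?g u)"] unfolding w_def[symmetric] not_less[symmetric] by blast+
      have "w \<notin> U \<inter> ?S"
      proof
        assume "w \<in> U \<inter> ?S"
        then obtain v where v: "v \<in> U" "w = v + s" "v + s \<in> U" by blast
        have "arg_min_on (\<lambda>u\<in>U. \<pi> (a (T u x))) U = v + s"
        proof (rule argmin[OF \<pi> v(3)])
          show "inj_on (\<lambda>u. a (T u x)) U" using inj by (rule inj_on_subset) (use sW in blast)
          show "\<pi> (a (T (v + s) x)) \<le> \<pi> (a (T u x))" if "u \<in> U" for u
            using w(2)[of u] that unfolding v(2) by blast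
        qed
        moreover have "arg_min_on (\<lambda>u\<in>U. \<pi> (a (T u (T s x)))) U = v"
        proof (rule argmin[OF \<pi> v(1)])
          have T: "T u (T s x) = T (u + s) x" for u using flow_add[OF x] by simp
          show "inj_on (\<lambda>u. a (T u (T s x))) U"
            unfolding T
          proof (rule inj_onI)
            fix u v assume uv: "u \<in> U" "v \<in> U" "a (T (u + s) x) = a (T (v + s) x)"
            have "u + s \<in> ?S" "v + s \<in> ?S" using uv(1,2) by blast+
            then have "u + s \<in> W" "v + s \<in> W" using subsetD[OF sW] by blast+
            from inj_onD[OF inj uv(3) this] show "u = v" by simp
          qed
          show "\<pi> (a (T v (T s x))) \<le> \<pi> (a (T u (T s x)))" if "u \<in> U" for u
            unfolding T using w(2)[of "u + s"] that unfolding v(2) by blast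
        qed
        ultimately have "\<phi> \<pi> (T s x) = \<phi> \<pi> x + c s" unfolding \<phi>_def using h[OF s v(1,3)] by simp
        with bx show False by simp
      qed
      with w(1) have "w \<in> (U - ?S) \<union> (?S - U)" by auto
      then have "?g w \<in> ?C" by (rule imageI)
      moreover have "\<forall>d'\<in>?D. \<pi> (?g w) \<le> \<pi> d'" using w(2) by (intro ballI) (erule imageE, simp)
      ultimately show "\<pi> \<in> {\<pi>. \<pi> permutes A \<and> (\<exists>d\<in>?C. \<forall>d'\<in>?D. \<pi> d \<le> \<pi> d')}"
        using \<pi> by (intro CollectI conjI bexI[of _ "?g w"])
    qed
    moreover have "finite {\<pi>. \<pi> permutes A \<and> (\<exists>d\<in>?C. \<forall>d'\<in>?D. \<pi> d \<le> \<pi> d')}"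
      by (rule finite_subset[OF _ finite_permutations[OF finA]]) blast
    moreover define X where "X = card {\<pi>. \<pi> permutes A \<and> x \<in> bad s \<pi>}"
    ultimately have "X \<le> card {\<pi>. \<pi> permutes A \<and> (\<exists>d\<in>?C. \<forall>d'\<in>?D. \<pi> d \<le> \<pi> d')}"
      unfolding X_def by (intro card_mono)
    then have "X * card ?D \<le> card {\<pi>. \<pi> permutes A \<and> (\<exists>d\<in>?C. \<forall>d'\<in>?D. \<pi> d \<le> \<pi> d')} * card ?D"
      by (rule mult_le_mono1)
    also have "\<dots> = card ?C * fact (card A)"
    proof (rule card_permutes_argmin[OF finA])
      show "?D \<subseteq> A" using aA by (intro image_subsetI)
      show "?C \<subseteq> ?D" by (intro image_mono) blast
    qed
    finally have XD: "X * card ?D \<le> card ?C * fact (card A)" .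
    have UD: "card U \<le> card ?D"
    proof -
      have "inj_on ?g (U \<union> ?S)" using inj sW by (rule inj_on_subset)
      then have "card ?D = card (U \<union> ?S)" by (rule card_image)
      also have "\<dots> \<ge> card U" using U by (intro card_mono) auto
      finally show ?thesis .
    qed
    have RC: "R * card ?C \<le> 2 * card U"
    proof -
      have "card ?C \<le> card ((U - ?S) \<union> (?S - U))" using U by (intro card_image_le) auto
      also have "\<dots> \<le> card (U - ?S) + card (?S - U)" by (rule card_Un_le)
      finally have "R * card ?C \<le> R * (card (U - ?S) + card (?S - U))" by (rule mult_left_mono) simp
      also have "\<dots> \<le> 2 * card U" using Fol1[OF s] Fol2[OF s] by (simp add: algebra_simps)
      finally show ?thesis .
    qed
    have "X * card U \<le> X * card ?D" using UD by simp
    also note XD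
    finally have "R * (X * card U) \<le> R * (card ?C * fact (card A))" by (rule mult_le_mono2)
    also have "\<dots> = R * card ?C * fact (card A)" by simp
    also have "\<dots> \<le> 2 * card U * fact (card A)" using RC by (rule mult_le_mono1)
    finally have "(R * X) * card U \<le> (2 * fact (card A)) * card U" by (simp add: mult_ac)
    moreover have "0 < card U" using U by (simp add: card_gt_0_iff)
    ultimately have "R * X \<le> 2 * fact (card A)" by simp
    then have "real (R * X) \<le> real (2 * fact (card A))" by (rule of_nat_mono)
    then have "real X * real R \<le> 2 * fact (card A)" by (simp add: mult.commute)
    then have "real X \<le> 2 * fact (card A) / real R" using R by (subst pos_le_divide_eq) simp_all
    then show ?thesis unfolding X_def[symmetric] by simp
  qed
  have finP: "finite {\<pi>. \<pi> permutes A}" using finA by (rule finite_permutations)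
  \<comment> \<open>Interchanging the sum over labellings with the integral reduces the average to
    the count at a fixed point.\<close>
  have "(\<Sum>\<pi> | \<pi> permutes A. measure M (\<Union>s\<in>F. bad s \<pi>)) \<le> (\<Sum>\<pi> | \<pi> permutes A. \<Sum>s\<in>F. measure M (bad s \<pi>))"
    by (intro sum_mono finite_measure_subadditive_finite) (use F bad_meas in auto)
  also have "\<dots> = (\<Sum>s\<in>F. \<Sum>\<pi> | \<pi> permutes A. measure M (bad s \<pi>))" by (rule sum.swap)
  also have "\<dots> \<le> (\<Sum>s\<in>F. 2 / R * fact (card A))"
  proof (rule sum_mono)
    fix s assume s: "s \<in> F"
    have int: "integrable M (indicator (bad s \<pi>) :: 'a \<Rightarrow> real)" if "\<pi> permutes A" for \<pi>
      using bad_meas[OF that] by (simp add: emeasure_eq_measure)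
    have "(\<Sum>\<pi> | \<pi> permutes A. measure M (bad s \<pi>)) = (\<Sum>\<pi> | \<pi> permutes A. LINT x|M. indicator (bad s \<pi>) x)"
      using bad_meas by (intro sum.cong) auto
    also have "\<dots> = (LINT x|M. (\<Sum>\<pi> | \<pi> permutes A. indicator (bad s \<pi>) x))"
      using int by (intro Bochner_Integration.integral_sum[symmetric]) auto
    also have "\<dots> \<le> (LINT x|M. 2 / R * fact (card A))"
    proof (rule integral_mono)
      show "integrable M (\<lambda>x. \<Sum>\<pi> | \<pi> permutes A. indicator (bad s \<pi>) x :: real)"
        using int by (intro Bochner_Integration.integrable_sum) auto
      fix x assume x: "x \<in> space M"
      have "(\<Sum>\<pi> | \<pi> permutes A. indicator (bad s \<pi>) x :: real) = real (card {\<pi>. \<pi> permutes A \<and> x \<in> bad s \<pi>})"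
      proof -
        have "(\<Sum>\<pi> | \<pi> permutes A. indicator (bad s \<pi>) x :: real) = (\<Sum>\<pi>\<in>{\<pi>. \<pi> permutes A}. if x \<in> bad s \<pi> then 1 else 0)"
          by (intro sum.cong refl) (simp add: indicator_def)
        also have "\<dots> = (\<Sum>\<pi>\<in>{\<pi> \<in> {\<pi>. \<pi> permutes A}. x \<in> bad s \<pi>}. 1)"
          by (rule sum.inter_filter[OF finP, symmetric])
        finally show ?thesis by simp
      qed
      then show "(\<Sum>\<pi> | \<pi> permutes A. indicator (bad s \<pi>) x :: real) \<le> 2 / R * fact (card A)" using count[OF s x] by simp
    qed simp
    finally show "(\<Sum>\<pi> | \<pi> permutes A. measure M (bad s \<pi>)) \<le> 2 / R * fact (card A)" by (simp add: prob_space)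
  qed
  also have "\<dots> = (\<Sum>\<pi> | \<pi> permutes A. 2 * real (card F) / R)"
    using card_permutations[OF refl finA] by simp
  also have "\<dots> \<le> (\<Sum>\<pi> | \<pi> permutes A. \<eta> / 2)" using RF by (intro sum_mono)
  finally have "\<not> (\<forall>\<pi>\<in>{\<pi>. \<pi> permutes A}. \<eta> / 2 < measure M (\<Union>s\<in>F. bad s \<pi>))"
  proof (rule contrapos_pn)
    assume *: "\<forall>\<pi>\<in>{\<pi>. \<pi> permutes A}. \<eta> / 2 < measure M (\<Union>s\<in>F. bad s \<pi>)"
    have "{\<pi>. \<pi> permutes A} \<noteq> {}" using permutes_id[of A] by blast
    from sum_strict_mono[OF finP this bspec[OF *]]
    show "\<not> (\<Sum>\<pi> | \<pi> permutes A. measure M (\<Union>s\<in>F. bad s \<pi>)) \<le> (\<Sum>\<pi> | \<pi> permutes A. \<eta> / 2)"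
      by (simp only: not_le)
  qed
  then obtain \<pi> where \<pi>: "\<pi> permutes A" "measure M (\<Union>s\<in>F. bad s \<pi>) \<le> \<eta> / 2" by (meson mem_Collect_eq not_less)
  let ?B = "B0 \<union> (\<Union>s\<in>F. bad s \<pi>)"
  have BS: "(\<Union>s\<in>F. bad s \<pi>) \<in> sets M" using F bad_meas[OF \<pi>(1)] by auto
  have "measure M ?B \<le> measure M B0 + measure M (\<Union>s\<in>F. bad s \<pi>)"
    using B0(1) BS by (rule measure_Un_le)
  also have "\<dots> \<le> \<eta>" using B0 \<pi> by simp
  finally have "measure M ?B \<le> \<eta>" .
  moreover have "?B \<in> sets M" using B0(1) BS by (rule sets.Un)
  moreover have "\<phi> \<pi> (T s x) = \<phi> \<pi> x + c s" if "x \<in> space M - ?B" "s \<in> F" for x s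
  proof (rule ccontr)
    assume "\<phi> \<pi> (T s x) \<noteq> \<phi> \<pi> x + c s"
    with that(1) have "x \<in> bad s \<pi>" unfolding bad_def by blast
    with that show False by blast
  qed
  ultimately show thesis by (intro that[OF \<phi>_meas[OF \<pi>(1)], of ?B])
qed

end

section \<open>Strong sweeping out\<close>

lemma exists_level_set_measure_le:
  fixes \<phi> :: "'a \<Rightarrow> int"
  assumes "prob_space M" and \<phi>: "\<phi> \<in> M \<rightarrow>\<^sub>M count_space UNIV" and m: "0 < (m::nat)"
  shows "\<exists>v\<in>{0..<int m}. measure M {x \<in> space M. \<phi> x mod int m = v} \<le> 1 / real m"
proof (rule ccontr)
  interpret prob_space M by fact
  assume neg: "\<not> ?thesis"
  let ?A = "\<lambda>v. {x \<in> space M. \<phi> x mod int m = v}"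
  have meas: "?A v \<in> sets M" for v
  proof -
    have "(\<phi> -` {y. y mod int m = v}) \<inter> space M \<in> sets M" using \<phi> by (rule measurable_sets) simp
    also have "(\<phi> -` {y. y mod int m = v}) \<inter> space M = ?A v" by auto
    finally show ?thesis .
  qed
  have "1 / real m < measure M (?A v)" if "v \<in> {0..<int m}" for v
    using neg that by (meson not_le)
  then have "(\<Sum>v\<in>{0..<int m}. 1 / real m) < (\<Sum>v\<in>{0..<int m}. measure M (?A v))"
    using m by (intro sum_strict_mono) simp_all
  also have "\<dots> = measure M (\<Union>v\<in>{0..<int m}. ?A v)"
    using meas by (intro finite_measure_finite_Union[symmetric]) (auto simp: disjoint_family_on_def)
  also have "\<dots> \<le> 1" by (rule prob_le_1)
  finally show False using m by simp
qed

text \<open>\<open>w div m ^ k mod m\<close> is the \<open>k\<close>-th digit in base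
  \<open>m\<close>, least significant first; the induction adds a leading digit.\<close>

lemma digits_surj:
  assumes "0 < (m::nat)" "\<And>k. k < K \<Longrightarrow> y k < m"
  shows "\<exists>w < m ^ K. \<forall>k<K. w div m ^ k mod m = y k"
  using assms(2)
proof (induction K)
  case 0
  then show ?case by simp
next
  case (Suc K)
  then obtain w where w: "w < m ^ K" "\<And>k. k < K \<Longrightarrow> w div m ^ k mod m = y k" by auto
  let ?w = "w + y K * m ^ K"
  have "?w div m ^ k mod m = y k" if "k < Suc K" for k
  proof (cases "k = K")
    case True
    then show ?thesis using w(1) Suc.prems[of K] assms(1) by simp
  next
    case False
    with that have k: "k < K" by simp
    then obtain j where "K = Suc (k + j)" using less_imp_Suc_add by blast
    then have e: "y K * m ^ K = (y K * m ^ j * m) * m ^ k" by (simp add: power_add)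
    have "m ^ k \<noteq> 0" using assms(1) by simp
    from div_mult_self1[OF this] have "?w div m ^ k = y K * m ^ j * m + w div m ^ k" unfolding e .
    then show ?thesis using w(2)[OF k] by simp
  qed
  moreover have "?w < m ^ Suc K"
  proof -
    have "?w < m ^ K + y K * m ^ K" using w(1) by simp
    also have "\<dots> = Suc (y K) * m ^ K" by simp
    also have "\<dots> \<le> m * m ^ K" using Suc.prems[of K] by (intro mult_right_mono) auto
    finally show ?thesis by simp
  qed
  ultimately show ?case by blast
qed

context aperiodic_dynamical_system begin

text \<open>At \<open>N = 0\<close> the quotient \<open>1 / real N\<close> is 0, so the average is 0
  there and the bounds by 0 and 1 hold for every \<open>N\<close>.\<close>

definition avg :: "(nat \<Rightarrow> real) \<Rightarrow> 'a set \<Rightarrow> nat \<Rightarrow> 'a \<Rightarrow> real" where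
  "avg s E N x = 1 / real N * (\<Sum>n=1..N. indicator E (T (s n) x))"

text \<open>The increment prescribed for class \<open>k\<close> in window \<open>w\<close> is the negative of the \<open>k\<close>-th digit of \<open>w\<close> in base
  \<open>m\<close>, so that the windows below \<open>m ^ K\<close> realise all increment vectors.\<close>

theorem exists_sweeping_set:
  assumes s: "indep_dense s" and \<epsilon>: "0 < \<epsilon>" "\<epsilon> \<le> 1"
  obtains E B N1 where "E \<in> sets M" "measure M E \<le> \<epsilon>" "B \<in> sets M" "measure M B \<le> \<epsilon>"
    "\<And>x. x \<in> space M - B \<Longrightarrow> \<exists>N\<in>{n0..N1}. avg s E N x \<ge> 1 - \<epsilon>"
proof -
  \<comment> \<open>One half of \<open>\<epsilon>\<close> pays for the indices before the chosen
    window, the other for the indices outside all classes.\<close>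
  define \<delta> where "\<delta> = \<epsilon> / 2"
  have \<delta>: "0 < \<delta>" "\<delta> \<le> 1" using \<epsilon> by (auto simp: \<delta>_def)
  obtain K Q n1 where ind: "\<And>k. k < (K::nat) \<Longrightarrow> inj_on s (Q k)" "\<And>k. k < K \<Longrightarrow> int_independent (s ` Q k)"
    and dens: "\<And>N. N \<ge> n1 \<Longrightarrow> real (card {n \<in> {1..N}. \<forall>k<K. n \<notin> Q k}) \<le> \<delta> * real N"
  proof -
    obtain K Q n1 where *: "\<forall>k<(K::nat). inj_on s (Q k) \<and> int_independent (s ` Q k)"
      "\<forall>N\<ge>n1. real (card {n \<in> {1..N}. \<forall>k<K. n \<notin> Q k}) \<le> \<delta> * real N"
      using s[unfolded indep_dense_def, rule_format, OF \<delta>(1)] by (elim exE conjE)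
    show ?thesis by (rule that[of K Q n1]) (use * in blast)+
  qed
  obtain m0 :: nat where m0: "real K / \<epsilon> < real m0" using reals_Archimedean2 by blast
  define m where "m = Suc m0"
  have m: "0 < m" "real K / real m \<le> \<epsilon>"
  proof -
    show "0 < m" by (simp add: m_def)
    have "real K < real m0 * \<epsilon>" using m0 \<epsilon>(1) by (simp add: pos_divide_less_eq)
    also have "\<dots> \<le> real m * \<epsilon>" using \<epsilon>(1) unfolding m_def by (intro mult_right_mono) simp_all
    finally show "real K / real m \<le> \<epsilon>" using \<open>0 < m\<close> by (simp add: pos_divide_le_eq mult.commute)
  qed
  \<comment> \<open>The growth ratio of the windows: \<open>Nw w\<close> is at most the fraction
    \<open>\<delta>\<close> of \<open>Nw (Suc w)\<close>.\<close>
  define C where "C = nat \<lceil>1 / \<delta>\<rceil>"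
  have C: "1 \<le> \<delta> * real C" "1 \<le> C"
  proof -
    have "1 / \<delta> \<le> real C" unfolding C_def by linarith
    then show *: "1 \<le> \<delta> * real C" using \<delta> by (simp add: field_simps)
    then show "1 \<le> C" by (cases C) auto
  qed
  define P where "P = max 1 (max n0 n1)"
  define Nw where "Nw w = P * C ^ w" for w :: nat
  have P1: "1 \<le> P" "n0 \<le> P" "n1 \<le> P" unfolding P_def by auto
  have Nw1: "1 \<le> Nw w" "P \<le> Nw w" for w
  proof -
    have "1 \<le> C ^ w" using C(2) by simp
    then have "P * 1 \<le> P * C ^ w" by (rule mult_le_mono2)
    then show "P \<le> Nw w" unfolding Nw_def by simp
    with P1(1) show "1 \<le> Nw w" by simp
  qed
  have Nw_step: "real (Nw w) \<le> \<delta> * real (Nw (Suc w))" for w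
  proof -
    have "real (Nw w) * 1 \<le> real (Nw w) * (\<delta> * real C)" using C(1) by (intro mult_left_mono) auto
    then show ?thesis unfolding Nw_def by (simp add: mult_ac)
  qed
  have Nw_mono: "Nw w \<le> Nw w'" if "w \<le> w'" for w w'
    unfolding Nw_def using C(2) that by (intro mult_left_mono power_increasing) auto
  define L where "L = m ^ K"
  \<comment> \<open>Window \<open>w\<close> runs from \<open>Nw w\<close>, excluded, to
    \<open>Nw (Suc w)\<close>. Indices up to \<open>Nw 0\<close> are also sent to window 0, which is
    harmless because everything up to \<open>Nw w\<close> is written off in the count.\<close>
  define win where "win n = (LEAST w. n \<le> Nw (Suc w))" for n
  have win: "win n = w" if "Nw w < n" "n \<le> Nw (Suc w)" for n w
    unfolding win_def
  proof (rule Least_equality)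
    show "n \<le> Nw (Suc w)" by (rule that(2))
    fix w' assume "n \<le> Nw (Suc w')"
    show "w \<le> w'"
    proof (rule ccontr)
      assume "\<not> w \<le> w'"
      then have "Nw (Suc w') \<le> Nw w" by (intro Nw_mono) simp
      then show False using \<open>n \<le> Nw (Suc w')\<close> that by simp
    qed
  qed
  define F where "F k = s ` (Q k \<inter> {1..Nw L})" for k
  \<comment> \<open>Increments have to be a function of the time; injectivity of \<open>s\<close> on
    \<open>Q k\<close> recovers the index, and with it the window.\<close>
  define c where "c k r = - int (win (the_inv_into (Q k) s r) div m ^ k mod m)" for k r
  have c: "c k (s n) = - int (win n div m ^ k mod m)" if "k < K" "n \<in> Q k" for k n
    unfolding c_def using the_inv_into_f_f[OF ind(1)[OF that(1)] that(2)] by simp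
  \<comment> \<open>\<open>Suc K\<close> keeps \<open>\<eta>\<close> positive even when
    \<open>K = 0\<close>.\<close>
  define \<eta> where "\<eta> = \<epsilon> / real (Suc K)"
  have \<eta>: "0 < \<eta>" "real K * \<eta> \<le> \<epsilon>" using \<epsilon> by (auto simp: \<eta>_def field_simps)
  have "\<exists>\<phi> B. \<phi> \<in> M \<rightarrow>\<^sub>M count_space UNIV \<and> B \<in> sets M \<and> measure M B \<le> \<eta> \<and>
      (\<forall>x\<in>space M - B. \<forall>r\<in>F k. \<phi> (T r x) = \<phi> x + c k r)" if k: "k < K" for k
  proof -
    have "finite (F k)" unfolding F_def by simp
    moreover have "int_independent (F k)"
      by (rule int_independent_subset[OF ind(2)[OF k]]) (auto simp: F_def)
    ultimately show ?thesis using exists_approx_equivariant[of "F k" \<eta> "c k"] \<eta>(1) by metis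
  qed
  then obtain \<phi> Bk where \<phi>: "\<And>k. k < K \<Longrightarrow> \<phi> k \<in> M \<rightarrow>\<^sub>M count_space UNIV"
    and Bk: "\<And>k. k < K \<Longrightarrow> Bk k \<in> sets M" "\<And>k. k < K \<Longrightarrow> measure M (Bk k) \<le> \<eta>"
    and eq: "\<And>k x r. k < K \<Longrightarrow> x \<in> space M - Bk k \<Longrightarrow> r \<in> F k \<Longrightarrow> \<phi> k (T r x) = \<phi> k x + c k r"
    by metis
  have "\<exists>v\<in>{0..<int m}. measure M {x \<in> space M. \<phi> k x mod int m = v} \<le> 1 / real m" if "k < K" for k
    by (rule exists_level_set_measure_le[OF _ \<phi>[OF that] m(1)]) unfold_locales
  then obtain v where v: "\<And>k. k < K \<Longrightarrow> v k \<in> {0..<int m}"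
    "\<And>k. k < K \<Longrightarrow> measure M {x \<in> space M. \<phi> k x mod int m = v k} \<le> 1 / real m" by metis
  define Ek where "Ek k = {x \<in> space M. \<phi> k x mod int m = v k}" for k
  have Ek: "Ek k \<in> sets M" if "k < K" for k
  proof -
    have "(\<phi> k -` {y. y mod int m = v k}) \<inter> space M \<in> sets M" using \<phi>[OF that] by (rule measurable_sets) simp
    also have "(\<phi> k -` {y. y mod int m = v k}) \<inter> space M = Ek k" unfolding Ek_def by auto
    finally show ?thesis .
  qed
  define E where "E = (\<Union>k<K. Ek k)"
  define B where "B = (\<Union>k<K. Bk k)"
  show thesis
  proof (rule that)
    show "E \<in> sets M" "B \<in> sets M" unfolding E_def B_def using Ek Bk(1) by auto
    have "measure M E \<le> (\<Sum>k<K. measure M (Ek k))"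
      unfolding E_def by (rule finite_measure_subadditive_finite) (use Ek in auto)
    also have "\<dots> \<le> (\<Sum>k<K. 1 / real m)" using v(2) unfolding Ek_def by (intro sum_mono) auto
    also have "\<dots> \<le> \<epsilon>" using m by simp
    finally show "measure M E \<le> \<epsilon>" .
    have "measure M B \<le> (\<Sum>k<K. measure M (Bk k))"
      unfolding B_def by (rule finite_measure_subadditive_finite) (use Bk in auto)
    also have "\<dots> \<le> (\<Sum>k<K. \<eta>)" using Bk(2) by (intro sum_mono) auto
    also have "\<dots> \<le> \<epsilon>" using \<eta> by simp
    finally show "measure M B \<le> \<epsilon>" .
  next
    fix x assume x: "x \<in> space M - B"
    \<comment> \<open>The residue to be subtracted from \<open>\<phi> k x\<close> to reach the rare
      value \<open>v k\<close>. The window \<open>w\<close> having these residues as digits is the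
      one in which \<open>x\<close> is sent into \<open>E\<close> at all times from the
      classes.\<close>
    define y where "y k = nat ((\<phi> k x - v k) mod int m)" for k
    have "y k < m" for k using m(1) unfolding y_def by (simp add: nat_less_iff)
    then obtain w where w: "w < L" "\<And>k. k < K \<Longrightarrow> w div m ^ k mod m = y k"
      using digits_surj[OF m(1), of K y] unfolding L_def by auto
    define N where "N = Nw (Suc w)"
    have hit: "T (s n) x \<in> E" if n: "n \<in> Q k" "k < K" "Nw w < n" "n \<le> N" for n k
    proof -
      have NL: "N \<le> Nw L" unfolding N_def using w(1) by (intro Nw_mono) simp
      then have "s n \<in> F k" unfolding F_def using n Nw1[of w] by (intro imageI) auto
      then have "\<phi> k (T (s n) x) = \<phi> k x + c k (s n)" using eq[OF n(2)] x n(2) unfolding B_def by auto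
      also have "c k (s n) = - int (y k)" using c[OF n(2,1)] win n w(2)[OF n(2)] unfolding N_def by simp
      also have "int (y k) = (\<phi> k x - v k) mod int m" unfolding y_def using m(1) by simp
      finally have "\<phi> k (T (s n) x) mod int m = (\<phi> k x - (\<phi> k x - v k) mod int m) mod int m" by simp
      also have "\<dots> = v k mod int m" by (simp add: mod_diff_right_eq)
      also have "\<dots> = v k"
        using v(1)[OF n(2)] by simp
      finally have "T (s n) x \<in> Ek k" unfolding Ek_def using x measurable_space[OF transformation_measurable] by auto
      then show ?thesis using n(2) unfolding E_def by auto
    qed
    let ?bad = "{n \<in> {1..N}. T (s n) x \<notin> E}"
    have "?bad \<subseteq> {1..Nw w} \<union> {n \<in> {1..N}. \<forall>k<K. n \<notin> Q k}" using hit by (auto simp: not_le)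
    then have "card ?bad \<le> card ({1..Nw w} \<union> {n \<in> {1..N}. \<forall>k<K. n \<notin> Q k})" by (intro card_mono) auto
    also have "\<dots> \<le> card {1..Nw w} + card {n \<in> {1..N}. \<forall>k<K. n \<notin> Q k}" by (rule card_Un_le)
    finally have "real (card ?bad) \<le> real (Nw w) + real (card {n \<in> {1..N}. \<forall>k<K. n \<notin> Q k})" by simp
    also have "\<dots> \<le> \<delta> * real N + \<delta> * real N"
    proof (rule add_mono)
      show "real (Nw w) \<le> \<delta> * real N" unfolding N_def by (rule Nw_step)
      have "n1 \<le> N" using Nw1(2)[of "Suc w"] P1(3) unfolding N_def by simp
      then show "real (card {n \<in> {1..N}. \<forall>k<K. n \<notin> Q k}) \<le> \<delta> * real N" by (rule dens)
    qed
    also have "\<dots> = \<epsilon> * real N" by (simp add: \<delta>_def)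
    finally have bad: "real (card ?bad) \<le> \<epsilon> * real N" .
    have "(\<Sum>n=1..N. indicator E (T (s n) x)) = real (card {n \<in> {1..N}. T (s n) x \<in> E})"
      by (simp add: indicator_def sum.If_cases Int_def)
    moreover have "card {n \<in> {1..N}. T (s n) x \<in> E} + card ?bad = card {1..N}"
    proof -
      have "{n \<in> {1..N}. T (s n) x \<in> E} \<union> ?bad = {1..N}" by blast
      moreover have "card ({n \<in> {1..N}. T (s n) x \<in> E} \<union> ?bad) = card {n \<in> {1..N}. T (s n) x \<in> E} + card ?bad"
        by (rule card_Un_disjoint) auto
      ultimately show ?thesis by simp
    qed
    then have "real (card {n \<in> {1..N}. T (s n) x \<in> E}) + real (card ?bad) = real N"
      by (simp flip: of_nat_add)
    ultimately have "(\<Sum>n=1..N. indicator E (T (s n) x)) \<ge> (1 - \<epsilon>) * real N" using bad by (simp add: algebra_simps)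
    moreover have "0 < N" using Nw1[of "Suc w"] unfolding N_def by simp
    ultimately have "avg s E N x \<ge> 1 - \<epsilon>" unfolding avg_def by (simp add: field_simps)
    moreover have "N \<in> {n0..Nw L}"
      using Nw1(2)[of "Suc w"] P1(2) Nw_mono[of "Suc w" L] w(1) unfolding N_def by auto
    ultimately show "\<exists>N\<in>{n0..Nw L}. avg s E N x \<ge> 1 - \<epsilon>" by blast
  qed
qed

end

section \<open>From sweeping sets to oscillating averages\<close>

lemma limsup_ereal_eq_1:
  fixes X :: "nat \<Rightarrow> real"
  assumes le: "\<And>N. X N \<le> 1" and freq: "\<And>e m. 0 < e \<Longrightarrow> \<exists>N\<ge>m. 1 - e \<le> X N"
  shows "limsup (\<lambda>N. ereal (X N)) = 1"
proof (rule antisym)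
  show "limsup (\<lambda>N. ereal (X N)) \<le> 1"
    by (rule Limsup_bounded) (use le in simp)
  show "1 \<le> limsup (\<lambda>N. ereal (X N))"
  proof (rule ccontr)
    assume "\<not> 1 \<le> limsup (\<lambda>N. ereal (X N))"
    then obtain y where y: "limsup (\<lambda>N. ereal (X N)) < ereal y" "ereal y < 1"
      using ereal_dense2[of "limsup (\<lambda>N. ereal (X N))" 1] by (auto simp: not_le)
    from Limsup_lessD[OF y(1)] obtain m where m: "\<And>N. m \<le> N \<Longrightarrow> X N < y"
      unfolding eventually_sequentially by auto
    have "0 < 1 - y" using y(2) by simp
    from freq[OF this, of m] obtain N where "m \<le> N" "1 - (1 - y) \<le> X N" by blast
    then show False using m[of N] by simp
  qed
qed

lemma liminf_ereal_eq_0: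
  fixes X :: "nat \<Rightarrow> real"
  assumes ge: "\<And>N. 0 \<le> X N" and freq: "\<And>e m. 0 < e \<Longrightarrow> \<exists>N\<ge>m. X N \<le> e"
  shows "liminf (\<lambda>N. ereal (X N)) = 0"
proof (rule antisym)
  show "0 \<le> liminf (\<lambda>N. ereal (X N))"
    by (rule Liminf_bounded) (use ge in simp)
  show "liminf (\<lambda>N. ereal (X N)) \<le> 0"
  proof (rule ccontr)
    assume "\<not> liminf (\<lambda>N. ereal (X N)) \<le> 0"
    then obtain y where y: "0 < ereal y" "ereal y < liminf (\<lambda>N. ereal (X N))"
      using ereal_dense2[of 0 "liminf (\<lambda>N. ereal (X N))"] by (auto simp: not_le)
    from less_LiminfD[OF y(2)] obtain m where m: "\<And>N. m \<le> N \<Longrightarrow> y < X N"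
      unfolding eventually_sequentially by auto
    have "0 < y" using y(1) by simp
    from freq[OF this, of m] obtain N where "m \<le> N" "X N \<le> y" by blast
    then show False using m[of N] by simp
  qed
qed

context aperiodic_dynamical_system begin

lemma avg_nonneg: "0 \<le> avg s E N x"
  unfolding avg_def by (intro mult_nonneg_nonneg sum_nonneg) auto

lemma avg_mono:
  assumes "\<And>n. n \<in> {1..N} \<Longrightarrow> T (s n) x \<in> E \<Longrightarrow> T (s n) x \<in> E'"
  shows "avg s E N x \<le> avg s E' N x"
  unfolding avg_def by (intro mult_left_mono sum_mono) (use assms in \<open>auto simp: indicator_def\<close>)

lemma avg_disjoint:
  assumes "\<And>n. n \<in> {1..N} \<Longrightarrow> T (s n) x \<in> E \<Longrightarrow> T (s n) x \<notin> E'"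
  shows "avg s E N x + avg s E' N x \<le> 1"
proof -
  have "(\<Sum>n=1..N. indicator E (T (s n) x)) + (\<Sum>n=1..N. indicator E' (T (s n) x)) \<le> (\<Sum>n=1..N. 1 :: real)"
    unfolding sum.distrib[symmetric] by (intro sum_mono) (use assms in \<open>auto simp: indicator_def\<close>)
  then have "1 / real N * ((\<Sum>n=1..N. indicator E (T (s n) x)) + (\<Sum>n=1..N. indicator E' (T (s n) x)))
      \<le> 1 / real N * real N"
    by (intro mult_left_mono) simp_all
  also have "\<dots> \<le> 1" by simp
  finally show ?thesis unfolding avg_def by (simp only: distrib_left)
qed

lemma avg_le_1: "avg s E N x \<le> 1"
  using avg_disjoint[of N s x E "{}"] avg_nonneg[of s "{}" N x] by simp

text \<open>Stages with even index push the averages towards 1, those with odd index towards 0; a stage is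
  undone only by later stages, whose total measure is negligible compared with the reciprocal of the
  number \<open>n k\<close> of times that stage \<open>k\<close> looks at.\<close>

theorem strong_sweeping_out:
  assumes s: "indep_dense s" and \<epsilon>: "0 < \<epsilon>"
  shows "\<exists>E\<in>sets M. measure M E < \<epsilon> \<and>
    (AE x in M. limsup (\<lambda>N. ereal (avg s E N x)) = 1) \<and>
    (AE x in M. liminf (\<lambda>N. ereal (avg s E N x)) = 0)"
proof -
  \<comment> \<open>The side conditions on \<open>e\<close> sit inside the existential so that total
    choice functions result; the recursion for the tolerances needs \<open>N'\<close> as a function
    of tolerance and stage.\<close>
  have "\<forall>e n0. \<exists>E B N1. 0 < e \<longrightarrow> e \<le> 1 \<longrightarrow> (E \<in> sets M \<and> measure M E \<le> e \<and> B \<in> sets M \<and> measure M B \<le> e \<and>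
    (\<forall>x\<in>space M - B. \<exists>N\<in>{n0..N1}. avg s E N x \<ge> 1 - e))"
  proof (intro allI)
    fix e :: real and n0 :: nat
    show "\<exists>E B N1. 0 < e \<longrightarrow> e \<le> 1 \<longrightarrow> (E \<in> sets M \<and> measure M E \<le> e \<and> B \<in> sets M \<and> measure M B \<le> e \<and>
      (\<forall>x\<in>space M - B. \<exists>N\<in>{n0..N1}. avg s E N x \<ge> 1 - e))"
    proof (cases "0 < e \<and> e \<le> 1")
      case True
      obtain E B N1 where "E \<in> sets M" "measure M E \<le> e" "B \<in> sets M" "measure M B \<le> e"
        "\<And>x. x \<in> space M - B \<Longrightarrow> \<exists>N\<in>{n0..N1}. avg s E N x \<ge> 1 - e"
        by (rule exists_sweeping_set[OF s conjunct1[OF True] conjunct2[OF True], of n0]) (rule that)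
      then show ?thesis by (intro exI[of _ E] exI[of _ B] exI[of _ N1]) simp
    qed simp
  qed
  then obtain E' B' N' where sweep: "\<And>e n0. 0 < e \<Longrightarrow> e \<le> 1 \<Longrightarrow> E' e n0 \<in> sets M \<and> measure M (E' e n0) \<le> e \<and>
      B' e n0 \<in> sets M \<and> measure M (B' e n0) \<le> e \<and>
      (\<forall>x\<in>space M - B' e n0. \<exists>N\<in>{n0..N' e n0}. avg s (E' e n0) N x \<ge> 1 - e)"
    unfolding choice_iff by blast
  \<comment> \<open>The factor 2 gives geometric decay. Dividing by \<open>n k + 1\<close> keeps the
    \<open>n k\<close> preimages of the union of later sets, which has measure at most
    \<open>2 * e (Suc k)\<close>, below \<open>e k\<close> in total. The start
    \<open>\<epsilon> / 4\<close> bounds the union of all stages by \<open>\<epsilon> / 2\<close>,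
    and \<open>min 1\<close> meets the requirement \<open>e \<le> 1\<close> of the sweeping
    sets.\<close>
  define e where "e = rec_nat (min 1 (\<epsilon> / 4)) (\<lambda>k r. r / (2 * (real (N' r k) + 1)))"
  define n where "n k = N' (e k) k" for k
  have e0: "e 0 = min 1 (\<epsilon> / 4)" and eS: "e (Suc k) = e k / (2 * (real (n k) + 1))" for k
    unfolding e_def n_def by simp_all
  have epos: "0 < e k" for k
    by (induction k) (use \<epsilon> in \<open>auto simp: e0 eS\<close>)
  have ehalf: "e (Suc k) \<le> e k / 2" for k
    unfolding eS using epos[of k] by (intro divide_left_mono) auto
  have epow: "e (k + i) \<le> e k * (1 / 2) ^ i" for k i
  proof (induction i)
    case (Suc i)
    then show ?case using ehalf[of "k + i"] by simp
  qed simp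
  have e1: "e k \<le> 1" for k
  proof -
    have "e (0 + k) \<le> e 0 * (1 / 2) ^ k" by (rule epow)
    also have "\<dots> \<le> 1 * 1" using epos[of 0] by (intro mult_mono) (auto simp: e0 power_le_one)
    finally show ?thesis by simp
  qed
  define E where "E k = E' (e k) k" for k
  define B where "B k = B' (e k) k" for k
  have E: "E k \<in> sets M" "measure M (E k) \<le> e k" and B: "B k \<in> sets M" "measure M (B k) \<le> e k"
    and hit: "\<And>x. x \<in> space M - B k \<Longrightarrow> \<exists>N\<in>{k..n k}. avg s (E k) N x \<ge> 1 - e k" for k
    using sweep[OF epos e1, of k k] unfolding E_def B_def n_def by auto
  have geo: "summable (\<lambda>i. e k * (1 / 2) ^ i)" "(\<Sum>i. e k * (1 / 2) ^ i) = 2 * e k" for k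
    using sums_mult[OF geometric_sums[of "1 / 2 :: real"], of "e k"] by (auto simp: sums_iff)
  have union: "measure M (\<Union>i. E (k + i)) \<le> 2 * e k" for k
  proof -
    have le: "measure M (E (k + i)) \<le> e k * (1 / 2) ^ i" for i using E(2)[of "k + i"] epow[of k i] by linarith
    have sm: "summable (\<lambda>i. measure M (E (k + i)))"
      by (rule summable_comparison_test'[OF geo(1)[of k], of 0]) (use le in simp)
    have "measure M (\<Union>i. E (k + i)) \<le> (\<Sum>i. measure M (E (k + i)))"
      by (rule finite_measure_subadditive_countably) (use E sm in auto)
    also have "\<dots> \<le> (\<Sum>i. e k * (1 / 2) ^ i)" by (rule suminf_le[OF le sm geo(1)])
    also have "\<dots> = 2 * e k" by (rule geo(2))
    finally show ?thesis .
  qed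
  define L where "L k = (\<Union>i. E (Suc k + i))" for k
  have L: "L k \<in> sets M" for k unfolding L_def using E(1) by auto
  \<comment> \<open>For a point in at least one but only finitely many \<open>E k\<close>, the
    parity of the last such index decides. So for a point of \<open>E k\<close> outside
    \<open>L k\<close>, membership in \<open>G\<close> depends only on the parity of
    \<open>k\<close>.\<close>
  define G where "G = (\<Union>k\<in>{k. even k}. E k - (\<Union>i\<in>{i. odd i \<and> k < i}. E i))"
  have G: "G \<in> sets M"
    unfolding G_def by (intro sets.countable_UN'' sets.Diff E(1) countableI_type)
  have inL: "y \<in> L k" if "y \<in> E j" "k < j" for y j k
    unfolding L_def using that by (intro UN_I[of "j - Suc k"]) auto
  have "measure M G \<le> measure M (\<Union>i. E (0 + i))"
    using E(1) by (intro finite_measure_mono) (auto simp: G_def)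
  also have "\<dots> \<le> 2 * e 0" by (rule union)
  also have "\<dots> < \<epsilon>" using \<epsilon> by (simp add: e0 min_def)
  finally have Gm: "measure M G < \<epsilon>" .
  have Geven: "y \<in> G" if "y \<in> E k" "even k" "y \<notin> L k" for y k
    unfolding G_def using that inL by (intro UN_I[of k]) auto
  have Godd: "y \<notin> G" if "y \<in> E k" "odd k" "y \<notin> L k" for y k
  proof
    assume "y \<in> G"
    then obtain j where j: "even j" "y \<in> E j" "\<And>i. odd i \<Longrightarrow> j < i \<Longrightarrow> y \<notin> E i" unfolding G_def by auto
    from j(1) that(2) have "j \<noteq> k" by auto
    then consider "j < k" | "k < j" by linarith
    then show False using j that inL[of y j k] by cases auto
  qed
  \<comment> \<open>Stage \<open>k\<close> can go wrong at \<open>x\<close> in two ways: the sweep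
    fails, or \<open>x\<close> enters a later set at one of the first \<open>n k\<close> times. The
    measures of these sets are summable, so almost every point avoids \<open>C k\<close> for all
    large \<open>k\<close>.\<close>
  define C where "C k = B k \<union> (\<Union>i\<in>{1..n k}. T (s i) -` L k \<inter> space M)" for k
  have TL: "T t -` L k \<inter> space M \<in> sets M" for t k
    using transformation_measurable L by (rule measurable_sets)
  have UTL: "(\<Union>i\<in>{1..n k}. T (s i) -` L k \<inter> space M) \<in> sets M" for k
    by (rule sets.finite_UN[OF finite_atLeastAtMost TL])
  have C: "C k \<in> sets M" for k unfolding C_def by (rule sets.Un[OF B(1) UTL])
  have Cm: "measure M (C k) \<le> 2 * e k" for k
  proof -
    have "measure M (C k) \<le> measure M (B k) + measure M (\<Union>i\<in>{1..n k}. T (s i) -` L k \<inter> space M)"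
      unfolding C_def by (rule measure_Un_le[OF B(1) UTL])
    also have "measure M (\<Union>i\<in>{1..n k}. T (s i) -` L k \<inter> space M) \<le> (\<Sum>i\<in>{1..n k}. measure M (T (s i) -` L k \<inter> space M))"
      by (rule finite_measure_subadditive_finite) (use TL in auto)
    also have "\<dots> = real (n k) * measure M (L k)" using flow_measure[OF L] by simp
    also have "\<dots> \<le> real (n k) * (2 * e (Suc k))" using union[of "Suc k"] unfolding L_def by (intro mult_left_mono) auto
    also have "\<dots> \<le> e k"
    proof -
      have "2 * e (Suc k) = e k / (real (n k) + 1)" unfolding eS by (simp add: field_simps)
      then have "real (n k) * (2 * e (Suc k)) = e k * (real (n k) / (real (n k) + 1))" by simp
      also have "\<dots> \<le> e k * 1" using epos[of k] by (intro mult_left_mono) auto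
      finally show ?thesis by simp
    qed
    finally show ?thesis using B(2)[of k] by simp
  qed
  have "AE x in M. eventually (\<lambda>k. x \<in> space M - C k) sequentially"
  proof (rule borel_cantelli_AE1)
    show "C k \<in> sets M" for k by (rule C)
    show "emeasure M (C k) < \<infinity>" for k by (simp add: emeasure_eq_measure)
    have le: "norm (measure M (C k)) \<le> 2 * (e 0 * (1 / 2) ^ k)" for k using Cm[of k] epow[of 0 k] by simp
    show "summable (\<lambda>k. measure M (C k))"
      by (rule summable_comparison_test'[OF summable_mult[OF geo(1)[of 0], of 2], of 0]) (use le in simp)
  qed
  then have ev: "AE x in M. x \<in> space M \<and> eventually (\<lambda>k. x \<in> space M - C k) sequentially"
    using AE_space by eventually_elim simp
  have elim: "e \<longlonglongrightarrow> 0"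
  proof (rule tendsto_sandwich[of "\<lambda>_. 0" _ _ "\<lambda>k. e 0 * (1 / 2) ^ k"])
    show "(\<lambda>k. e 0 * (1 / 2) ^ k) \<longlonglongrightarrow> 0" using summable_LIMSEQ_zero[OF geo(1)[of 0]] .
  qed (use epos epow[of 0] in \<open>auto intro!: always_eventually less_imp_le\<close>)
  have "(\<forall>d m. 0 < d \<longrightarrow> (\<exists>N\<ge>m. 1 - d \<le> avg s G N x)) \<and> (\<forall>d m. 0 < d \<longrightarrow> (\<exists>N\<ge>m. avg s G N x \<le> d))"
    if x: "x \<in> space M" and evx: "eventually (\<lambda>k. x \<in> space M - C k) sequentially" for x
  proof -
    have good: "\<exists>k0. \<forall>k\<ge>k0. e k \<le> d \<and> m \<le> k \<and> x \<in> space M - C k" if "0 < d" for d m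
    proof -
      have "eventually (\<lambda>k. e k < d) sequentially" using order_tendstoD(2)[OF elim that] .
      with evx eventually_ge_at_top[of m] have "eventually (\<lambda>k. e k \<le> d \<and> m \<le> k \<and> x \<in> space M - C k) sequentially"
        by eventually_elim auto
      then show ?thesis unfolding eventually_sequentially .
    qed
    have stage: "\<exists>N\<ge>k. 1 - e k \<le> avg s (E k) N x \<and> (\<forall>i\<in>{1..N}. T (s i) x \<notin> L k)"
      if k: "x \<in> space M - C k" for k
    proof -
      obtain N where N: "N \<in> {k..n k}" "1 - e k \<le> avg s (E k) N x" using hit[of x k] k unfolding C_def by blast
      then show ?thesis using k unfolding C_def by (intro exI[of _ N]) auto
    qed
    show ?thesis
    proof (intro conjI allI impI)
      fix d :: real and m :: nat assume d: "0 < d"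
      obtain k0 where k0: "\<And>k. k0 \<le> k \<Longrightarrow> e k \<le> d \<and> m \<le> k \<and> x \<in> space M - C k" using good[OF d, of m] by blast
      have k: "e (2 * k0) \<le> d" "m \<le> 2 * k0" "x \<in> space M - C (2 * k0)" using k0[of "2 * k0"] by auto
      obtain N where N: "2 * k0 \<le> N" "1 - e (2 * k0) \<le> avg s (E (2 * k0)) N x"
        "\<forall>i\<in>{1..N}. T (s i) x \<notin> L (2 * k0)" using stage[OF k(3)] by blast
      have "avg s (E (2 * k0)) N x \<le> avg s G N x"
        by (rule avg_mono) (use N(3) in \<open>auto intro: Geven[of _ "2 * k0"]\<close>)
      then show "\<exists>N\<ge>m. 1 - d \<le> avg s G N x" using N k by (intro exI[of _ N]) auto
      have k: "e (2 * k0 + 1) \<le> d" "m \<le> 2 * k0 + 1" "x \<in> space M - C (2 * k0 + 1)" using k0[of "2 * k0 + 1"] by auto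
      obtain N where N: "2 * k0 + 1 \<le> N" "1 - e (2 * k0 + 1) \<le> avg s (E (2 * k0 + 1)) N x"
        "\<forall>i\<in>{1..N}. T (s i) x \<notin> L (2 * k0 + 1)" using stage[OF k(3)] by blast
      have "avg s (E (2 * k0 + 1)) N x + avg s G N x \<le> 1"
        by (rule avg_disjoint) (rule Godd[of _ "2 * k0 + 1"], use N(3) in auto)
      then show "\<exists>N\<ge>m. avg s G N x \<le> d" using N k by (intro exI[of _ N]) auto
    qed
  qed
  then have lim: "limsup (\<lambda>N. ereal (avg s G N x)) = 1 \<and> liminf (\<lambda>N. ereal (avg s G N x)) = 0"
    if "x \<in> space M" "eventually (\<lambda>k. x \<in> space M - C k) sequentially" for x
    using that by (intro conjI limsup_ereal_eq_1 liminf_ereal_eq_0 avg_le_1 avg_nonneg) blast+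
  from ev have "AE x in M. limsup (\<lambda>N. ereal (avg s G N x)) = 1 \<and> liminf (\<lambda>N. ereal (avg s G N x)) = 0"
    by eventually_elim (use lim in blast)
  then show ?thesis using G Gm by (intro bexI[of _ G]) auto
qed

end

section \<open>Products of fractional powers\<close>

definition power_free :: "nat \<Rightarrow> nat \<Rightarrow> bool" where
  "power_free b j \<longleftrightarrow> 0 < j \<and> (\<forall>p. prime p \<longrightarrow> \<not> p ^ b dvd j)"

text \<open>Take \<open>q\<close> maximal with \<open>q ^ b\<close> dividing \<open>n\<close>: a
  prime \<open>p\<close> with \<open>p ^ b\<close> dividing the cofactor would allow the larger
  \<open>q * p\<close>.\<close>

lemma exists_power_free_decomposition:
  fixes n b :: nat
  assumes n: "0 < n" and b: "0 < b"
  shows "\<exists>q j. 0 < q \<and> power_free b j \<and> n = q ^ b * j"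
proof -
  have bd: "q \<le> n" if "q ^ b dvd n" for q
  proof -
    have "q \<le> q ^ b" using b by (cases "q = 0") (auto intro: self_le_power)
    also have "\<dots> \<le> n" using that n by (simp add: dvd_imp_le)
    finally show ?thesis .
  qed
  define q where "q = Max {q. q ^ b dvd n}"
  have fin: "finite {q. q ^ b dvd n}" by (rule finite_subset[of _ "{..n}"]) (use bd in auto)
  have ne: "1 \<in> {q. q ^ b dvd n}" by simp
  have "q \<in> {q. q ^ b dvd n}" unfolding q_def by (rule Max_in[OF fin]) (use ne in blast)
  then have q: "q ^ b dvd n" by simp
  have qmax: "r \<le> q" if "r ^ b dvd n" for r using Max_ge[OF fin] that unfolding q_def by simp
  have q1: "0 < q" using qmax[of 1] by simp
  obtain j where j: "n = q ^ b * j" using q by (elim dvdE)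
  have "\<not> p ^ b dvd j" if "prime p" for p
  proof
    assume "p ^ b dvd j"
    then have "(q * p) ^ b dvd n" unfolding j power_mult_distrib by (rule mult_dvd_mono[OF dvd_refl])
    then have "q * p \<le> q * 1" using qmax by simp
    then show False using q1 that prime_gt_1_nat[OF that] by simp
  qed
  moreover have "0 < j" using n j by (cases j) auto
  ultimately show ?thesis using q1 j unfolding power_free_def by blast
qed

lemma multiplicity_less_power_free:
  assumes "power_free b' j" "prime p"
  shows "multiplicity p j < b'"
proof (rule ccontr)
  assume "\<not> multiplicity p j < b'"
  then have "p ^ b' dvd j" by (intro multiplicity_dvd') simp
  then show False using assms unfolding power_free_def by blast
qed

text \<open>The exponents after cancelling common factors: in lowest terms, a non-integer exponent
  is one with denominator at least 2.\<close>

locale reduced_exponents =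
  fixes I :: "'i set" and a b :: "'i \<Rightarrow> nat" and \<alpha> :: "'i \<Rightarrow> real"
  assumes I: "finite I" "I \<noteq> {}"
    and a: "\<And>i. i \<in> I \<Longrightarrow> 0 < a i" and b: "\<And>i. i \<in> I \<Longrightarrow> 2 \<le> b i"
    and ab: "\<And>i. i \<in> I \<Longrightarrow> coprime (a i) (b i)"
    and \<alpha>: "\<And>i. i \<in> I \<Longrightarrow> \<alpha> i = real (a i) / real (b i)"
    and bb: "\<And>i j. i \<in> I \<Longrightarrow> j \<in> I \<Longrightarrow> i \<noteq> j \<Longrightarrow> coprime (b i) (b j)"
begin

definition \<Theta> :: "('i \<Rightarrow> nat) \<Rightarrow> real" where
  "\<Theta> n = (\<Prod>i\<in>I. real (n i) powr \<alpha> i)"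

definition B :: nat where "B = (\<Prod>i\<in>I. b i)"

text \<open>The cofactor \<open>B / b i\<close>. As in the Chinese remainder theorem, it is prime to
  \<open>b i\<close> and divisible by every other \<open>b k\<close>, so reduction modulo
  \<open>b k\<close> isolates the \<open>k\<close>-th coordinate.\<close>

definition co :: "'i \<Rightarrow> nat" where "co i = (\<Prod>k\<in>I - {i}. b k)"

lemma B_co: "i \<in> I \<Longrightarrow> B = b i * co i"
  unfolding B_def co_def using I(1) by (rule prod.remove)

lemma B_pos: "0 < B"
  unfolding B_def using b by (intro prod_pos) fastforce

lemma coprime_co: "i \<in> I \<Longrightarrow> coprime (co i) (b i)"
  unfolding co_def by (rule prod_coprime_left) (use bb in auto)

lemma dvd_co: "i \<in> I \<Longrightarrow> k \<in> I \<Longrightarrow> i \<noteq> k \<Longrightarrow> b k dvd co i"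
  unfolding co_def using I(1) by (intro dvd_prodI) auto

lemma \<alpha>_pos: "i \<in> I \<Longrightarrow> 0 < \<alpha> i"
  using a b \<alpha> by fastforce

lemma \<Theta>_pos: "(\<And>i. i \<in> I \<Longrightarrow> 0 < n i) \<Longrightarrow> 0 < \<Theta> n"
  unfolding \<Theta>_def by (intro prod_pos) auto

lemma \<Theta>_power_B:
  assumes n: "\<And>i. i \<in> I \<Longrightarrow> 0 < n i"
  shows "\<Theta> n ^ B = real (\<Prod>i\<in>I. n i ^ (a i * co i))"
proof -
  have "(real (n i) powr \<alpha> i) ^ B = real (n i ^ (a i * co i))" if i: "i \<in> I" for i
  proof -
    have "\<alpha> i * real B = real (a i * co i)" using b[OF i] by (simp add: \<alpha>[OF i] B_co[OF i])
    then have "(real (n i) powr \<alpha> i) ^ B = real (n i) powr real (a i * co i)"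
      by (subst powr_realpow'[symmetric]) (use B_pos n[OF i] in \<open>auto simp: powr_powr\<close>)
    also have "\<dots> = real (n i) ^ (a i * co i)" by (rule powr_realpow) (use n[OF i] in simp)
    finally show ?thesis by simp
  qed
  then show ?thesis unfolding \<Theta>_def by (simp add: prod_power_distrib)
qed

lemma \<Theta>_mult: "\<Theta> (\<lambda>i. m i * n i) = \<Theta> m * \<Theta> n"
  unfolding \<Theta>_def by (simp add: powr_mult prod.distrib)

lemma \<Theta>_power: "(\<And>i. i \<in> I \<Longrightarrow> 0 < q i) \<Longrightarrow> \<Theta> (\<lambda>i. q i ^ b i) = real (\<Prod>i\<in>I. q i ^ a i)"
proof -
  assume q: "\<And>i. i \<in> I \<Longrightarrow> 0 < q i"
  have "real (q i ^ b i) powr \<alpha> i = real (q i ^ a i)" if i: "i \<in> I" for i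
  proof -
    have "real (q i ^ b i) = real (q i) powr real (b i)" using q[OF i] by (simp add: powr_realpow)
    then have "real (q i ^ b i) powr \<alpha> i = real (q i) powr (real (b i) * \<alpha> i)" by (simp add: powr_powr)
    also have "real (b i) * \<alpha> i = real (a i)" using b[OF i] \<alpha>[OF i] by simp
    finally show ?thesis using q[OF i] by (simp add: powr_realpow)
  qed
  then show ?thesis unfolding \<Theta>_def by simp
qed

text \<open>Raising to the power \<open>B\<close> gives an identity of integers. The multiplicities
  of a prime in it, taken modulo \<open>b k\<close>, involve only the \<open>k\<close>-th
  coordinate, multiplied by the unit \<open>a k * co k\<close>. By power-freeness both
  multiplicities lie below \<open>b k\<close>, so their congruence is an equality.\<close>

lemma \<Theta>_ratio_rational:
  assumes j: "\<And>i. i \<in> I \<Longrightarrow> power_free (b i) (j i)" and j': "\<And>i. i \<in> I \<Longrightarrow> power_free (b i) (j' i)"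
    and rat: "\<Theta> j / \<Theta> j' \<in> \<rat>" and k: "k \<in> I"
  shows "j k = j' k"
proof -
  have jp: "0 < j i" "0 < j' i" if "i \<in> I" for i using j[OF that] j'[OF that] by (auto simp: power_free_def)
  have pos: "0 < \<Theta> j" "0 < \<Theta> j'" using jp by (auto intro: \<Theta>_pos)
  obtain u v :: nat where uv: "v \<noteq> 0" "\<bar>\<Theta> j / \<Theta> j'\<bar> = real u / real v" "coprime u v"
    by (rule Rats_abs_nat_div_natE[OF rat])
  have u0: "u \<noteq> 0"
  proof
    assume "u = 0"
    then have "\<Theta> j / \<Theta> j' = 0" using uv(2) by simp
    then show False using pos by simp
  qed
  have "\<Theta> j * real v = \<Theta> j' * real u" using uv pos by (simp add: field_simps)
  then have "(\<Theta> j * real v) ^ B = (\<Theta> j' * real u) ^ B" by simp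
  then have "\<Theta> j ^ B * real v ^ B = \<Theta> j' ^ B * real u ^ B" unfolding power_mult_distrib .
  then have "real ((\<Prod>i\<in>I. j i ^ (a i * co i)) * v ^ B) = real ((\<Prod>i\<in>I. j' i ^ (a i * co i)) * u ^ B)"
  proof -
    have "\<Theta> j ^ B = real (\<Prod>i\<in>I. j i ^ (a i * co i))" using jp(1) by (rule \<Theta>_power_B)
    moreover have "\<Theta> j' ^ B = real (\<Prod>i\<in>I. j' i ^ (a i * co i))" using jp(2) by (rule \<Theta>_power_B)
    ultimately show ?thesis using \<open>\<Theta> j ^ B * real v ^ B = \<Theta> j' ^ B * real u ^ B\<close>
      by (simp only: of_nat_mult of_nat_power)
  qed
  then have eq: "(\<Prod>i\<in>I. j i ^ (a i * co i)) * v ^ B = (\<Prod>i\<in>I. j' i ^ (a i * co i)) * u ^ B"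
    by (simp only: of_nat_eq_iff)
  have mult: "multiplicity p ((\<Prod>i\<in>I. n i ^ (a i * co i)) * w ^ B) =
      (\<Sum>i\<in>I. a i * co i * multiplicity p (n i)) + B * multiplicity p w"
    if p: "prime p" and n: "\<And>i. i \<in> I \<Longrightarrow> 0 < n i" and w: "w \<noteq> 0" for p w :: nat and n
  proof -
    have pe: "prime_elem p" using p by simp
    have P0: "(\<Prod>i\<in>I. n i ^ (a i * co i)) \<noteq> 0" using n I(1) by simp
    have z: "0 \<notin> (\<lambda>i. n i ^ (a i * co i)) ` I" using n by fastforce
    have "multiplicity p (\<Prod>i\<in>I. n i ^ (a i * co i)) = (\<Sum>i\<in>I. multiplicity p (n i ^ (a i * co i)))"
      using prime_elem_multiplicity_prod_distrib[OF pe z I(1)] .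
    also have "\<dots> = (\<Sum>i\<in>I. a i * co i * multiplicity p (n i))"
      by (intro sum.cong refl prime_elem_multiplicity_power_distrib[OF pe]) (use n in auto)
    finally show ?thesis using prime_elem_multiplicity_mult_distrib[OF pe P0, of "w ^ B"] w
      prime_elem_multiplicity_power_distrib[OF pe w, of B] by simp
  qed
  have "multiplicity p (j k) = multiplicity p (j' k)" if p: "prime p" for p
  proof -
    have red: "[(\<Sum>i\<in>I. a i * co i * multiplicity p (n i)) + B * x = a k * co k * multiplicity p (n k)] (mod b k)"
      for n :: "'i \<Rightarrow> nat" and x
    proof -
      have "b k dvd (\<Sum>i\<in>I - {k}. a i * co i * multiplicity p (n i)) + B * x"
      proof (rule dvd_add)
        show "b k dvd (\<Sum>i\<in>I - {k}. a i * co i * multiplicity p (n i))"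
        proof (rule dvd_sum)
          fix i assume "i \<in> I - {k}"
          then have "b k dvd co i" using dvd_co[of i k] k by blast
          then show "b k dvd a i * co i * multiplicity p (n i)" by (intro dvd_mult2 dvd_mult)
        qed
        show "b k dvd B * x" unfolding B_co[OF k] by simp
      qed
      then obtain y where y: "(\<Sum>i\<in>I - {k}. a i * co i * multiplicity p (n i)) + B * x = b k * y" by (elim dvdE)
      have "(\<Sum>i\<in>I. a i * co i * multiplicity p (n i)) + B * x = a k * co k * multiplicity p (n k) + b k * y"
        unfolding y[symmetric] sum.remove[OF I(1) k] by (simp only: add.assoc)
      then show ?thesis unfolding cong_def by (simp only: mod_mult_self2)
    qed
    have m: "(\<Sum>i\<in>I. a i * co i * multiplicity p (j i)) + B * multiplicity p v =
        (\<Sum>i\<in>I. a i * co i * multiplicity p (j' i)) + B * multiplicity p u"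
    proof -
      have "multiplicity p ((\<Prod>i\<in>I. j i ^ (a i * co i)) * v ^ B) =
          (\<Sum>i\<in>I. a i * co i * multiplicity p (j i)) + B * multiplicity p v"
        by (rule mult[OF p _ uv(1)]) (rule jp(1))
      moreover have "multiplicity p ((\<Prod>i\<in>I. j' i ^ (a i * co i)) * u ^ B) =
          (\<Sum>i\<in>I. a i * co i * multiplicity p (j' i)) + B * multiplicity p u"
        by (rule mult[OF p _ u0]) (rule jp(2))
      ultimately show ?thesis unfolding eq by (simp only:)
    qed
    have "[a k * co k * multiplicity p (j k) = (\<Sum>i\<in>I. a i * co i * multiplicity p (j' i)) + B * multiplicity p u] (mod b k)"
      using cong_sym[OF red[of j "multiplicity p v"]] unfolding m .
    then have "[a k * co k * multiplicity p (j k) = a k * co k * multiplicity p (j' k)] (mod b k)"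
      using red[of j' "multiplicity p u"] by (rule cong_trans)
    moreover have "coprime (a k * co k) (b k)" using ab[OF k] coprime_co[OF k] by simp
    ultimately have "[multiplicity p (j k) = multiplicity p (j' k)] (mod b k)"
      by (simp add: cong_mult_lcancel_nat)
    then show ?thesis
      using multiplicity_less_power_free[OF j[OF k] p] multiplicity_less_power_free[OF j'[OF k] p] by (simp add: cong_def)
  qed
  then show ?thesis by (rule multiplicity_eq_nat[OF jp[OF k]])
qed

definition scaled_class :: "('i \<Rightarrow> nat) \<Rightarrow> real set" where
  "scaled_class q = {\<Theta> (\<lambda>i. q i ^ b i * j i) | j. \<forall>i\<in>I. power_free (b i) (j i)}"

lemma int_independent_scaled_class:
  assumes q: "\<And>i. i \<in> I \<Longrightarrow> 0 < q i"
  shows "int_independent (scaled_class q)"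
  unfolding int_independent_def
proof (intro allI impI ballI)
  fix F and k :: "real \<Rightarrow> int" and x
  assume F: "finite F" "F \<subseteq> scaled_class q" and rel: "(\<Sum>x\<in>F. of_int (k x) * x) = 0" and x: "x \<in> F"
  let ?c = "real (\<Prod>i\<in>I. q i ^ a i)"
  have elem: "\<exists>j. (\<forall>i\<in>I. power_free (b i) (j i)) \<and> y = ?c * \<Theta> j" if "y \<in> F" for y
  proof -
    have "\<exists>j. (\<forall>i\<in>I. power_free (b i) (j i)) \<and> y = \<Theta> (\<lambda>i. q i ^ b i * j i)"
      using that F(2) unfolding scaled_class_def by blast
    then show ?thesis using \<Theta>_power[of q] q by (simp add: \<Theta>_mult)
  qed
  have c: "0 < ?c" using q by (simp add: prod_pos)
  have "of_int (k x) = (0 :: rat)"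
  proof (rule radicals_linearly_independent[where x = "\<lambda>y. y" and c = "\<lambda>y. of_int (k y)" and N = B, OF F(1) B_pos _ _ _ _ x])
    fix y assume "y \<in> F"
    then obtain j where j: "\<And>i. i \<in> I \<Longrightarrow> power_free (b i) (j i)" "y = ?c * \<Theta> j" using elem by blast
    then have jp: "0 < j i" if "i \<in> I" for i using that by (auto simp: power_free_def)
    show "0 < y" unfolding j(2) using c \<Theta>_pos[of j] jp by simp
    have "\<Theta> j ^ B = real (\<Prod>i\<in>I. j i ^ (a i * co i))" using jp by (rule \<Theta>_power_B)
    then show "y ^ B \<in> \<rat>" unfolding j(2) power_mult_distrib by (simp only: Rats_mult Rats_power Rats_of_nat)
    fix y' assume "y' \<in> F" and ne: "y \<noteq> y'"
    then obtain j' where j': "\<And>i. i \<in> I \<Longrightarrow> power_free (b i) (j' i)" "y' = ?c * \<Theta> j'" using elem by blast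
    show "y / y' \<notin> \<rat>"
    proof
      assume "y / y' \<in> \<rat>"
      then have "\<Theta> j / \<Theta> j' \<in> \<rat>" using c unfolding j(2) j'(2) by simp
      then have "j i = j' i" if "i \<in> I" for i using \<Theta>_ratio_rational[OF j(1) j'(1)] that by blast
      then have "\<Theta> j = \<Theta> j'" unfolding \<Theta>_def by simp
      then show False using ne j(2) j'(2) by simp
    qed
  next
    show "(\<Sum>y\<in>F. of_rat (of_int (k y)) * y) = 0" using rel by simp
  qed
  then show "k x = 0" by simp
qed

end

section \<open>Counting products of powers below a bound\<close>

definition power_tuples :: "'i set \<Rightarrow> ('i \<Rightarrow> real) \<Rightarrow> real \<Rightarrow> ('i \<Rightarrow> nat) set" where
  "power_tuples J \<alpha> t = {n \<in> J \<rightarrow>\<^sub>E {1..}. (\<Prod>i\<in>J. real (n i) powr \<alpha> i) \<le> t}"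

lemma one_le_powr: "1 \<le> n \<Longrightarrow> 0 < x \<Longrightarrow> 1 \<le> real n powr x"
  by (simp add: ge_one_powr_ge_zero)

text \<open>Summing over a further coordinate \<open>m\<close> with exponent
  \<open>\<alpha> i\<close> multiplies the bound by the series of
  \<open>m powr - (\<alpha> i / \<alpha> i0)\<close>, which converges because
  \<open>\<alpha> i0\<close> is strictly smaller. Counting tuples instead of values is enough for an
  upper bound.\<close>

lemma power_tuples_bound:
  assumes J: "finite J" and i0: "i0 \<notin> J" "0 < \<alpha> i0" and gt: "\<And>i. i \<in> J \<Longrightarrow> \<alpha> i0 < \<alpha> i"
  shows "\<exists>A>0. \<forall>t>0. finite (power_tuples (insert i0 J) \<alpha> t) \<and>
    real (card (power_tuples (insert i0 J) \<alpha> t)) \<le> A * t powr (1 / \<alpha> i0)"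
  using J i0(1) gt
proof (induction J)
  case empty
  have "finite (power_tuples {i0} \<alpha> t) \<and> real (card (power_tuples {i0} \<alpha> t)) \<le> 1 * t powr (1 / \<alpha> i0)"
    if t: "0 < t" for t
  proof -
    define M where "M = nat \<lfloor>t powr (1 / \<alpha> i0)\<rfloor>"
    have sub: "(\<lambda>n. n i0) ` power_tuples {i0} \<alpha> t \<subseteq> {1..M}"
    proof
      fix m assume "m \<in> (\<lambda>n. n i0) ` power_tuples {i0} \<alpha> t"
      then have m: "1 \<le> m" "real m powr \<alpha> i0 \<le> t" unfolding power_tuples_def by auto
      have "real m = (real m powr \<alpha> i0) powr (1 / \<alpha> i0)" using m i0(2) by (simp add: powr_powr)
      also have "\<dots> \<le> t powr (1 / \<alpha> i0)" using m i0(2) by (intro powr_mono2) auto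
      finally have "m \<le> M" unfolding M_def by linarith
      then show "m \<in> {1..M}" using m by simp
    qed
    have inj: "inj_on (\<lambda>n. n i0) (power_tuples {i0} \<alpha> t)"
      unfolding power_tuples_def by (intro inj_onI PiE_ext[of _ "{i0}" "\<lambda>_. {1..}"]) auto
    have "card (power_tuples {i0} \<alpha> t) \<le> card {1..M}" by (rule card_inj_on_le[OF inj sub]) simp
    then have "real (card (power_tuples {i0} \<alpha> t)) \<le> real M" by simp
    also have "\<dots> \<le> t powr (1 / \<alpha> i0)" unfolding M_def by simp
    finally show ?thesis using inj_on_finite[OF inj sub] by simp
  qed
  then show ?case by (intro exI[of _ 1]) auto
next
  case (insert i J)
  then obtain A where A: "0 < A" "\<And>t. 0 < t \<Longrightarrow> finite (power_tuples (insert i0 J) \<alpha> t)"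
    "\<And>t. 0 < t \<Longrightarrow> real (card (power_tuples (insert i0 J) \<alpha> t)) \<le> A * t powr (1 / \<alpha> i0)" by auto
  have ai: "\<alpha> i0 < \<alpha> i" "i \<noteq> i0" using insert.prems by auto
  then have ai0: "0 < \<alpha> i" using i0(2) by simp
  have apos: "0 < \<alpha> k" if "k \<in> insert i0 J" for k using that insert.prems(2)[of k] i0(2) by force
  have "- (\<alpha> i / \<alpha> i0) < -1" using ai i0(2) by (simp add: field_simps)
  then have sm: "summable (\<lambda>m. real m powr - (\<alpha> i / \<alpha> i0))" by (simp add: summable_real_powr_iff)
  define Z where "Z = (\<Sum>m. real m powr - (\<alpha> i / \<alpha> i0))"
  have "finite (power_tuples (insert i0 (insert i J)) \<alpha> t) \<and>
     real (card (power_tuples (insert i0 (insert i J)) \<alpha> t)) \<le> (A * (Z + 1)) * t powr (1 / \<alpha> i0)" if t: "0 < t" for t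
  proof -
    define M where "M = nat \<lfloor>t powr (1 / \<alpha> i)\<rfloor>"
    let ?X = "\<lambda>m. power_tuples (insert i0 J) \<alpha> (t / real m powr \<alpha> i)"
    have sub: "power_tuples (insert i0 (insert i J)) \<alpha> t \<subseteq> (\<Union>m\<in>{1..M}. (\<lambda>n. n(i := m)) ` ?X m)"
    proof
      fix n assume n: "n \<in> power_tuples (insert i0 (insert i J)) \<alpha> t"
      then have n1: "n \<in> insert i (insert i0 J) \<rightarrow>\<^sub>E {1..}" unfolding power_tuples_def by (simp add: insert_commute)
      then have ni: "1 \<le> n i" by auto
      have "(\<Prod>k\<in>insert i0 (insert i J). real (n k) powr \<alpha> k) = real (n i) powr \<alpha> i * (\<Prod>k\<in>insert i0 J. real (n k) powr \<alpha> k)"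
        using insert.hyps ai insert_commute[of i0 i J] by simp
      with n have le: "real (n i) powr \<alpha> i * (\<Prod>k\<in>insert i0 J. real (n k) powr \<alpha> k) \<le> t" unfolding power_tuples_def by simp
      have p1: "1 \<le> (\<Prod>k\<in>insert i0 J. real (n k) powr \<alpha> k)"
        by (rule prod_ge_1) (use n1 apos one_le_powr in auto)
      have pi: "0 < real (n i) powr \<alpha> i" using ni by simp
      have "real (n i) powr \<alpha> i * 1 \<le> real (n i) powr \<alpha> i * (\<Prod>k\<in>insert i0 J. real (n k) powr \<alpha> k)"
        using p1 pi by (intro mult_left_mono) auto
      with le have "real (n i) powr \<alpha> i \<le> t" by simp
      then have "(real (n i) powr \<alpha> i) powr (1 / \<alpha> i) \<le> t powr (1 / \<alpha> i)" using ai0 by (intro powr_mono2) auto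
      then have "real (n i) \<le> t powr (1 / \<alpha> i)" using ni ai0 by (simp add: powr_powr)
      then have "n i \<in> {1..M}" using ni unfolding M_def by (simp add: le_nat_floor)
      moreover have "n(i := undefined) \<in> ?X (n i)"
      proof -
        have "(\<Prod>k\<in>insert i0 J. real ((n(i := undefined)) k) powr \<alpha> k) = (\<Prod>k\<in>insert i0 J. real (n k) powr \<alpha> k)"
          using insert.hyps ai by (intro prod.cong refl) auto
        moreover have "(\<Prod>k\<in>insert i0 J. real (n k) powr \<alpha> k) \<le> t / real (n i) powr \<alpha> i"
          using le pi by (simp add: pos_le_divide_eq mult.commute)
        moreover have "n(i := undefined) \<in> insert i0 J \<rightarrow>\<^sub>E {1..}"
          using n1 insert.hyps ai by (auto simp: PiE_iff extensional_def)
        ultimately show ?thesis unfolding power_tuples_def by simp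
      qed
      moreover have "n = (n(i := undefined))(i := n i)" by simp
      ultimately show "n \<in> (\<Union>m\<in>{1..M}. (\<lambda>n. n(i := m)) ` ?X m)" by blast
    qed
    have tm: "0 < t / real m powr \<alpha> i" if "m \<in> {1..M}" for m using t that by simp
    have finX: "finite (\<Union>m\<in>{1..M}. (\<lambda>n. n(i := m)) ` ?X m)"
      by (intro finite_UN_I finite_imageI A(2) tm finite_atLeastAtMost)
    have "card (power_tuples (insert i0 (insert i J)) \<alpha> t) \<le> card (\<Union>m\<in>{1..M}. (\<lambda>n. n(i := m)) ` ?X m)"
      by (rule card_mono[OF finX sub])
    also have "\<dots> \<le> (\<Sum>m\<in>{1..M}. card ((\<lambda>n. n(i := m)) ` ?X m))" by (rule card_UN_le) simp
    also have "\<dots> \<le> (\<Sum>m\<in>{1..M}. card (?X m))" by (intro sum_mono card_image_le A(2) tm)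
    finally have "real (card (power_tuples (insert i0 (insert i J)) \<alpha> t)) \<le> real (\<Sum>m\<in>{1..M}. card (?X m))"
      by (rule of_nat_mono)
    also have "\<dots> = (\<Sum>m\<in>{1..M}. real (card (?X m)))" by simp
    also have "\<dots> \<le> (\<Sum>m\<in>{1..M}. A * t powr (1 / \<alpha> i0) * real m powr - (\<alpha> i / \<alpha> i0))"
    proof (rule sum_mono)
      fix m assume m: "m \<in> {1..M}"
      have "real (card (?X m)) \<le> A * (t / real m powr \<alpha> i) powr (1 / \<alpha> i0)" by (rule A(3)[OF tm[OF m]])
      also have "(t / real m powr \<alpha> i) powr (1 / \<alpha> i0) = t powr (1 / \<alpha> i0) * real m powr - (\<alpha> i / \<alpha> i0)"
      proof -
        have "(t / real m powr \<alpha> i) powr (1 / \<alpha> i0) = t powr (1 / \<alpha> i0) / (real m powr \<alpha> i) powr (1 / \<alpha> i0)"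
          by (rule powr_divide)
        also have "(real m powr \<alpha> i) powr (1 / \<alpha> i0) = real m powr (\<alpha> i / \<alpha> i0)" by (simp add: powr_powr)
        finally show ?thesis by (simp add: powr_minus_divide)
      qed
      finally show "real (card (?X m)) \<le> A * t powr (1 / \<alpha> i0) * real m powr - (\<alpha> i / \<alpha> i0)" by (simp only: mult.assoc)
    qed
    also have "\<dots> = A * t powr (1 / \<alpha> i0) * (\<Sum>m\<in>{1..M}. real m powr - (\<alpha> i / \<alpha> i0))" by (simp add: sum_distrib_left)
    also have "\<dots> \<le> A * t powr (1 / \<alpha> i0) * (Z + 1)"
    proof (rule mult_left_mono)
      have "(\<Sum>m\<in>{1..M}. real m powr - (\<alpha> i / \<alpha> i0)) \<le> Z"
        unfolding Z_def by (rule sum_le_suminf[OF sm]) auto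
      then show "(\<Sum>m\<in>{1..M}. real m powr - (\<alpha> i / \<alpha> i0)) \<le> Z + 1" by simp
    qed (use A(1) in simp)
    finally have "real (card (power_tuples (insert i0 (insert i J)) \<alpha> t)) \<le> (A * (Z + 1)) * t powr (1 / \<alpha> i0)"
      by (simp only: mult_ac)
    then show ?thesis using finite_subset[OF sub finX] by simp
  qed
  moreover have "0 < A * (Z + 1)"
  proof -
    have "0 \<le> Z" unfolding Z_def by (rule suminf_nonneg[OF sm]) simp
    then show ?thesis using A(1) by simp
  qed
  ultimately show ?case by blast
qed

text \<open>Telescoping of \<open>1 / M - 1 / (M + 1)\<close>, which dominates
  \<open>1 / (M + 1) ^ 2\<close>.\<close>

lemma sum_inverse_squares_tail:
  assumes "0 < D"
  shows "(\<Sum>d\<in>{D<..M}. 1 / real d ^ 2) \<le> 1 / real D"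
proof -
  have "(\<Sum>d\<in>{D<..M}. 1 / real d ^ 2) \<le> 1 / real D - 1 / real M" if "D \<le> M"
    using that
  proof (induction M rule: dec_induct)
    case base
    then show ?case by simp
  next
    case (step M)
    have M: "0 < real M" using assms step by simp
    have "{D<..Suc M} = insert (Suc M) {D<..M}" using step by auto
    then have "(\<Sum>d\<in>{D<..Suc M}. 1 / real d ^ 2) = 1 / real (Suc M) ^ 2 + (\<Sum>d\<in>{D<..M}. 1 / real d ^ 2)" by simp
    also have "1 / real (Suc M) ^ 2 \<le> 1 / (real M * real (Suc M))"
      using M by (intro divide_left_mono) (auto simp: power2_eq_square)
    also have "1 / (real M * real (Suc M)) = 1 / real M - 1 / real (Suc M)" using M by (simp add: field_simps)
    finally show ?case using step by simp
  qed
  moreover have "0 \<le> 1 / real M" by simp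
  ultimately show ?thesis using assms by (cases "D \<le> M") (auto intro: order_trans)
qed

context reduced_exponents begin

text \<open>Equality of the reduced fractions would make \<open>b i\<close> divide
  \<open>b k\<close>, against coprimality and \<open>b i \<ge> 2\<close>. This makes the smallest
  exponent unique, as the counting bound requires.\<close>

lemma \<alpha>_inj:
  assumes "i \<in> I" "k \<in> I" "i \<noteq> k"
  shows "\<alpha> i \<noteq> \<alpha> k"
proof
  assume "\<alpha> i = \<alpha> k"
  then have "real (a i) * real (b k) = real (a k) * real (b i)"
    using \<alpha>[OF assms(1)] \<alpha>[OF assms(2)] b[OF assms(1)] b[OF assms(2)] by (simp add: field_simps)
  then have "a i * b k = a k * b i" by (simp only: of_nat_mult[symmetric] of_nat_eq_iff)
  then have "b i dvd a i * b k" by simp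
  moreover have "coprime (b i) (a i)" using ab[OF assms(1)] by (simp only: coprime_commute)
  ultimately have "b i dvd b k" by (simp only: coprime_dvd_mult_right_iff)
  then have "is_unit (b i)" using bb[OF assms] by (rule coprime_common_divisor[rotated, OF dvd_refl])
  then show False using b[OF assms(1)] by simp
qed

lemma exists_dominant_exponent:
  "\<exists>i0\<in>I. \<forall>i\<in>I - {i0}. \<alpha> i0 < \<alpha> i"
proof -
  have "Min (\<alpha> ` I) \<in> \<alpha> ` I" by (rule Min_in) (use I in auto)
  then obtain i0 where i0: "i0 \<in> I" "\<alpha> i0 = Min (\<alpha> ` I)" by force
  have "\<alpha> i0 < \<alpha> i" if "i \<in> I" "i \<noteq> i0" for i
  proof -
    have "\<alpha> i0 \<le> \<alpha> i" unfolding i0(2) by (rule Min_le) (use I that in auto)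
    then show ?thesis using \<alpha>_inj[OF that(1) i0(1) that(2)] by simp
  qed
  then show ?thesis using i0(1) by blast
qed

lemma \<Theta>_fun_upd:
  assumes "i \<in> I" "d \<noteq> 0" "\<nu> i = d ^ b i * m"
  shows "\<Theta> \<nu> = real d ^ a i * \<Theta> (\<nu>(i := m))"
proof -
  have "real d ^ b i = real d powr real (b i)" using assms(2) by (simp add: powr_realpow)
  then have "(real d ^ b i) powr \<alpha> i = real d powr (real (b i) * \<alpha> i)" by (simp add: powr_powr)
  also have "real (b i) * \<alpha> i = real (a i)" using b[OF assms(1)] \<alpha>[OF assms(1)] by simp
  also have "real d powr real (a i) = real d ^ a i" using assms(2) by (simp add: powr_realpow)
  finally have d: "(real d ^ b i) powr \<alpha> i = real d ^ a i" .
  have "\<Theta> \<nu> = real (d ^ b i * m) powr \<alpha> i * (\<Prod>k\<in>I - {i}. real (\<nu> k) powr \<alpha> k)"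
    unfolding \<Theta>_def prod.remove[OF I(1) assms(1)] assms(3) ..
  also have "real (d ^ b i * m) powr \<alpha> i = real d ^ a i * real m powr \<alpha> i" by (simp add: powr_mult d)
  finally have 1: "\<Theta> \<nu> = real d ^ a i * (real m powr \<alpha> i * (\<Prod>k\<in>I - {i}. real (\<nu> k) powr \<alpha> k))"
    by (simp only: mult.assoc)
  have "(\<Prod>k\<in>I - {i}. real ((\<nu>(i := m)) k) powr \<alpha> k) = (\<Prod>k\<in>I - {i}. real (\<nu> k) powr \<alpha> k)"
    by (intro prod.cong refl) simp
  then have "\<Theta> (\<nu>(i := m)) = real m powr \<alpha> i * (\<Prod>k\<in>I - {i}. real (\<nu> k) powr \<alpha> k)"
    unfolding \<Theta>_def prod.remove[OF I(1) assms(1)] by simp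
  with 1 show ?thesis by simp
qed

text \<open>An index in no class has some \<open>q i > D\<close>; removing \<open>q i ^ b i\<close>
  leaves a tuple counted at level \<open>t / q i ^ a i\<close>, where \<open>t = s N\<close>. For
  \<open>d = q i\<close> the counting bound shrinks by \<open>d powr (a i / \<beta>)\<close>, and
  \<open>a i / \<beta> \<ge> b i \<ge> 2\<close> because \<open>\<beta>\<close> is the smallest
  exponent. The sum over \<open>d > D\<close> is thus of order
  \<open>t powr (1 / \<beta>) / D\<close>, and \<open>t powr (1 / \<beta>)\<close> is at most of
  order \<open>N\<close>.\<close>

theorem indep_dense_power_products:
  assumes mono: "strict_mono_on {1..} s" and img: "s ` {1..} = {\<Theta> n | n. \<forall>i\<in>I. 1 \<le> n i}"
  shows "indep_dense s"
  unfolding indep_dense_def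
proof (intro allI impI)
  fix \<delta> :: real assume \<delta>: "0 < \<delta>"
  obtain i0 where i0: "i0 \<in> I" "\<And>i. i \<in> I - {i0} \<Longrightarrow> \<alpha> i0 < \<alpha> i" using exists_dominant_exponent by blast
  define \<beta> where "\<beta> = \<alpha> i0"
  have \<beta>: "0 < \<beta>" unfolding \<beta>_def by (rule \<alpha>_pos[OF i0(1)])
  have \<beta>_le: "\<beta> \<le> \<alpha> i" if "i \<in> I" for i using i0(2)[of i] that unfolding \<beta>_def by (cases "i = i0") auto
  have "\<exists>A>0. \<forall>t>0. finite (power_tuples (insert i0 (I - {i0})) \<alpha> t) \<and>
    real (card (power_tuples (insert i0 (I - {i0})) \<alpha> t)) \<le> A * t powr (1 / \<alpha> i0)"
    by (rule power_tuples_bound) (use I(1) \<beta> i0(2) in \<open>auto simp: \<beta>_def\<close>)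
  then obtain A where A: "0 < A" "\<And>t. 0 < t \<Longrightarrow> finite (power_tuples I \<alpha> t)"
      "\<And>t. 0 < t \<Longrightarrow> real (card (power_tuples I \<alpha> t)) \<le> A * t powr (1 / \<beta>)"
    unfolding \<beta>_def insert_Diff[OF i0(1)] by blast
  \<comment> \<open>\<open>D\<close> absorbs the constant \<open>A\<close>, the union over
    \<open>I\<close> and the factor 2 from the comparison of \<open>t powr (1 / \<beta>)\<close>
    with \<open>N\<close>.\<close>
  define D where "D = Suc (nat \<lceil>2 * real (card I) * A / \<delta>\<rceil>)"
  have D: "0 < D" "2 * real (card I) * A / real D \<le> \<delta>"
  proof -
    show "0 < D" by (simp add: D_def)
    have "2 * real (card I) * A / \<delta> \<le> real D" unfolding D_def by linarith
    then have "2 * real (card I) * A \<le> real D * \<delta>" using \<delta> by (simp only: pos_divide_le_eq)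
    then show "2 * real (card I) * A / real D \<le> \<delta>" using \<open>0 < D\<close> by (simp add: pos_divide_le_eq mult.commute)
  qed
  define P where "P = I \<rightarrow>\<^sub>E {1..D}"
  have "finite P" unfolding P_def by (intro finite_PiE I(1)) simp
  from ex_bij_betw_nat_finite[OF this] obtain e where e: "bij_betw e {0..<card P} P" by blast
  define Q where "Q k = {n. 1 \<le> n \<and> s n \<in> scaled_class (e k)}" for k
  have sinj: "inj_on s {1..}" using mono by (rule strict_mono_on_imp_inj_on)
  have QP: "inj_on s (Q k) \<and> int_independent (s ` Q k)" if k: "k < card P" for k
  proof
    show "inj_on s (Q k)" by (rule inj_on_subset[OF sinj]) (auto simp: Q_def)
    have "e k \<in> P" using bij_betw_apply[OF e, of k] k by simp
    then have "int_independent (scaled_class (e k))" unfolding P_def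
      by (intro int_independent_scaled_class) (auto simp: PiE_iff Suc_le_eq)
    then show "int_independent (s ` Q k)" by (rule int_independent_subset) (auto simp: Q_def)
  qed
  have bound: "real (card {n \<in> {1..N}. \<forall>k<card P. n \<notin> Q k}) \<le> \<delta> * real N" if N: "1 \<le> N" for N
  proof -
    define t where "t = s N"
    have "t \<in> s ` {1..}" unfolding t_def using N by (intro imageI) simp
    then obtain \<nu> where \<nu>: "\<forall>i\<in>I. 1 \<le> \<nu> i" "t = \<Theta> \<nu>" unfolding img by blast
    have t1: "1 \<le> t" unfolding \<nu>(2) \<Theta>_def
      by (intro prod_ge_1 one_le_powr) (use \<nu>(1) \<alpha>_pos in simp_all)
    \<comment> \<open>Tuples with all coordinates 1 except at \<open>i0\<close> already contribute
      the distinct values \<open>m powr \<beta>\<close>; the factor 2 absorbs the rounding in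
      \<open>F\<close>.\<close>
    have lower: "t powr (1 / \<beta>) \<le> 2 * real N"
    proof -
      define F where "F = nat \<lfloor>t powr (1 / \<beta>)\<rfloor>"
      have "(\<lambda>m. real m powr \<beta>) ` {1..F} \<subseteq> s ` {1..N}"
      proof
        fix y assume "y \<in> (\<lambda>m. real m powr \<beta>) ` {1..F}"
        then obtain m where m: "m \<in> {1..F}" "y = real m powr \<beta>" by blast
        have "\<Theta> ((\<lambda>_. 1)(i0 := m)) = real m powr \<beta>"
          unfolding \<Theta>_def prod.remove[OF I(1) i0(1)] \<beta>_def by (simp add: prod.neutral)
        moreover have "\<forall>i\<in>I. 1 \<le> ((\<lambda>_. 1)(i0 := m)) i" using m by simp
        ultimately have "y \<in> s ` {1..}"
          unfolding img m(2) by (intro CollectI exI[of _ "(\<lambda>_. 1)(i0 := m)"] conjI) (simp only:)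
        then obtain k where k: "1 \<le> k" "y = s k" by auto
        have "real F \<le> t powr (1 / \<beta>)" unfolding F_def by simp
        moreover have "real m \<le> real F" using m(1) by simp
        ultimately have "real m \<le> t powr (1 / \<beta>)" by (rule order_trans[rotated])
        then have "real m powr \<beta> \<le> (t powr (1 / \<beta>)) powr \<beta>" using \<beta> by (intro powr_mono2) auto
        also have "\<dots> = t" using \<beta> t1 by (simp add: powr_powr)
        finally have "s k \<le> s N" using k m unfolding t_def by simp
        have "k \<le> N"
        proof (rule ccontr)
          assume "\<not> k \<le> N"
          then have "s N < s k" using k N by (intro strict_mono_onD[OF mono]) simp_all
          with \<open>s k \<le> s N\<close> show False by simp
        qed
        then show "y \<in> s ` {1..N}" using k by auto
      qed
      then have "card ((\<lambda>m. real m powr \<beta>) ` {1..F}) \<le> card (s ` {1..N})" by (intro card_mono) auto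
      also have "\<dots> \<le> N" using card_image_le[of "{1..N}" s] by simp
      also have "card ((\<lambda>m. real m powr \<beta>) ` {1..F}) = F"
      proof -
        have "inj_on (\<lambda>m. real m powr \<beta>) {1..F}"
        proof (rule inj_onI)
          fix m m' :: nat assume "real m powr \<beta> = real m' powr \<beta>"
          then have "(real m powr \<beta>) powr (1 / \<beta>) = (real m' powr \<beta>) powr (1 / \<beta>)" by simp
          then show "m = m'" using \<beta> by (simp add: powr_powr)
        qed
        then show ?thesis by (simp add: card_image)
      qed
      finally have "F \<le> N" .
      have "t powr (1 / \<beta>) < real F + 1" unfolding F_def by linarith
      then show ?thesis using \<open>F \<le> N\<close> N by linarith
    qed
    let ?bad = "{n \<in> {1..N}. \<forall>k<card P. n \<notin> Q k}"
    define M where "M = nat \<lceil>t\<rceil>"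
    let ?X = "\<lambda>i d. power_tuples I \<alpha> (t / real d ^ a i)"
    let ?C = "\<Union>i\<in>I. \<Union>d\<in>{D<..M}. (\<lambda>\<nu>. real d ^ a i * \<Theta> \<nu>) ` ?X i d"
    have "s ` ?bad \<subseteq> ?C"
    proof
      fix y assume "y \<in> s ` ?bad"
      then obtain n where n: "1 \<le> n" "n \<le> N" "\<And>k. k < card P \<Longrightarrow> n \<notin> Q k" "y = s n" by auto
      have "s n \<le> t" unfolding t_def using strict_mono_on_leD[OF mono, of n N] n by simp
      have "s n \<in> s ` {1..}" using n(1) by (intro imageI) simp
      then obtain \<nu> where \<nu>: "\<forall>i\<in>I. 1 \<le> \<nu> i" "s n = \<Theta> \<nu>" unfolding img by blast
      have "\<exists>q j. 0 < q \<and> power_free (b i) j \<and> \<nu> i = q ^ b i * j" if "i \<in> I" for i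
        by (rule exists_power_free_decomposition) (use \<nu>(1) b[OF that] that in \<open>auto simp: Suc_le_eq\<close>)
      then obtain q j where qj: "\<And>i. i \<in> I \<Longrightarrow> 0 < q i" "\<And>i. i \<in> I \<Longrightarrow> power_free (b i) (j i)"
        "\<And>i. i \<in> I \<Longrightarrow> \<nu> i = q i ^ b i * j i" by metis
      have "\<exists>i\<in>I. D < q i"
      proof (rule ccontr)
        assume "\<not> (\<exists>i\<in>I. D < q i)"
        then have "restrict q I \<in> P" unfolding P_def using qj(1) by (intro restrict_PiE_iff[THEN iffD2]) (auto simp: Suc_le_eq not_less)
        then obtain k where k: "k < card P" "e k = restrict q I" using e unfolding bij_betw_def by (metis atLeastLessThan_iff imageE)
        have "\<Theta> \<nu> = \<Theta> (\<lambda>i. e k i ^ b i * j i)" unfolding \<Theta>_def k(2) by (intro prod.cong refl) (simp add: qj(3))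
        then have "s n \<in> scaled_class (e k)" unfolding scaled_class_def \<nu>(2) using qj(2) by blast
        then show False using n(3)[OF k(1)] n(1) unfolding Q_def by simp
      qed
      then obtain i where i: "i \<in> I" "D < q i" by blast
      \<comment> \<open>Restricted to \<open>I\<close> because \<open>power_tuples\<close> consists
        of extensional functions.\<close>
      define \<nu>' where "\<nu>' = restrict (\<nu>(i := j i)) I"
      have \<nu>'1: "\<nu>' \<in> I \<rightarrow>\<^sub>E {1..}"
        unfolding \<nu>'_def using \<nu>(1) qj(2) by (intro restrict_PiE_iff[THEN iffD2]) (auto simp: power_free_def Suc_le_eq)
      have "\<Theta> \<nu>' = \<Theta> (\<nu>(i := j i))" unfolding \<nu>'_def \<Theta>_def by (intro prod.cong refl) simp
      then have eq: "\<Theta> \<nu> = real (q i) ^ a i * \<Theta> \<nu>'"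
        using \<Theta>_fun_upd[of i "q i" \<nu> "j i"] i(1) qj(3)[OF i(1)] qj(1)[OF i(1)] by simp
      have qpos: "0 < real (q i) ^ a i" using qj(1)[OF i(1)] by simp
      have "real (q i) ^ a i * \<Theta> \<nu>' \<le> t" using \<open>s n \<le> t\<close> \<nu>(2) eq by simp
      then have le: "\<Theta> \<nu>' \<le> t / real (q i) ^ a i" using qpos by (simp add: pos_le_divide_eq mult.commute)
      then have X: "\<nu>' \<in> ?X i (q i)" using \<nu>'1 unfolding power_tuples_def \<Theta>_def by simp
      have "1 \<le> \<Theta> \<nu>'" unfolding \<Theta>_def
        by (intro prod_ge_1 one_le_powr \<alpha>_pos) (use PiE_mem[OF \<nu>'1] in simp_all)
      then have "real (q i) ^ a i * 1 \<le> real (q i) ^ a i * \<Theta> \<nu>'" using qpos by (intro mult_left_mono) auto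
      then have "real (q i) ^ a i \<le> t" using \<open>real (q i) ^ a i * \<Theta> \<nu>' \<le> t\<close> by simp
      moreover have "real (q i) \<le> real (q i) ^ a i" using qj(1)[OF i(1)] a[OF i(1)] by (intro self_le_power) auto
      ultimately have "real (q i) \<le> t" by (rule order_trans[rotated])
      then have "q i \<le> M" unfolding M_def by linarith
      with i(2) have "q i \<in> {D<..M}" by simp
      moreover have "y = real (q i) ^ a i * \<Theta> \<nu>'" using n(4) \<nu>(2) eq by simp
      ultimately show "y \<in> ?C" using i(1) X by blast
    qed
    have td: "0 < t / real d ^ a i" if "d \<in> {D<..M}" for i d using t1 that by simp
    have finX: "finite (?X i d)" if "d \<in> {D<..M}" for i d by (rule A(2)[OF td[OF that]])
    have finC: "finite ?C" by (intro finite_UN_I finite_imageI I(1) finite_greaterThanAtMost finX)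
    have "card ?bad = card (s ` ?bad)"
      by (rule card_image[symmetric], rule inj_on_subset[OF sinj]) auto
    also have "\<dots> \<le> card ?C" by (rule card_mono[OF finC \<open>s ` ?bad \<subseteq> ?C\<close>])
    also have "\<dots> \<le> (\<Sum>i\<in>I. card (\<Union>d\<in>{D<..M}. (\<lambda>\<nu>. real d ^ a i * \<Theta> \<nu>) ` ?X i d))"
      by (rule card_UN_le[OF I(1)])
    also have "\<dots> \<le> (\<Sum>i\<in>I. \<Sum>d\<in>{D<..M}. card ((\<lambda>\<nu>. real d ^ a i * \<Theta> \<nu>) ` ?X i d))"
      by (intro sum_mono card_UN_le finite_greaterThanAtMost)
    also have "\<dots> \<le> (\<Sum>i\<in>I. \<Sum>d\<in>{D<..M}. card (?X i d))"
      by (intro sum_mono card_image_le finX)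
    finally have "real (card ?bad) \<le> real (\<Sum>i\<in>I. \<Sum>d\<in>{D<..M}. card (?X i d))" by (rule of_nat_mono)
    also have "\<dots> = (\<Sum>i\<in>I. \<Sum>d\<in>{D<..M}. real (card (?X i d)))" by (simp only: of_nat_sum)
    also have "\<dots> \<le> (\<Sum>i\<in>I. \<Sum>d\<in>{D<..M}. (A * (2 * real N)) * (1 / real d ^ 2))"
    proof (intro sum_mono)
      fix i d assume i: "i \<in> I" and d: "d \<in> {D<..M}"
      have d1: "1 \<le> real d" using d by simp
      have "real (card (?X i d)) \<le> A * (t / real d ^ a i) powr (1 / \<beta>)" by (rule A(3)[OF td[OF d]])
      also have "(t / real d ^ a i) powr (1 / \<beta>) = t powr (1 / \<beta>) / (real d ^ a i) powr (1 / \<beta>)" by (rule powr_divide)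
      also have "\<dots> \<le> (2 * real N) / real d ^ 2"
      proof (rule frac_le)
        show "0 < real d ^ 2" using d1 by simp
        have "real d ^ a i = real d powr real (a i)" using d1 by (simp add: powr_realpow)
        then have "(real d ^ a i) powr (1 / \<beta>) = real d powr (real (a i) / \<beta>)" by (simp add: powr_powr)
        moreover have "2 \<le> real (a i) / \<beta>"
        proof -
          have "2 * \<beta> \<le> real (b i) * \<alpha> i" using b[OF i] \<beta>_le[OF i] \<beta> by (intro mult_mono) auto
          also have "\<dots> = real (a i)" using \<alpha>[OF i] b[OF i] by simp
          finally show ?thesis using \<beta> by (simp only: pos_le_divide_eq)
        qed
        then have "real d powr 2 \<le> real d powr (real (a i) / \<beta>)" using d1 by (intro powr_mono) auto
        moreover have "real d powr 2 = real d ^ 2" using d1 by simp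
        ultimately show "real d ^ 2 \<le> (real d ^ a i) powr (1 / \<beta>)" by simp
      qed (use lower in auto)
      finally show "real (card (?X i d)) \<le> (A * (2 * real N)) * (1 / real d ^ 2)" using A(1) by simp
    qed
    also have "\<dots> = (\<Sum>i\<in>I. (A * (2 * real N)) * (\<Sum>d\<in>{D<..M}. 1 / real d ^ 2))"
      by (simp only: sum_distrib_left)
    also have "\<dots> \<le> (\<Sum>i\<in>I. (A * (2 * real N)) * (1 / real D))"
      using sum_inverse_squares_tail[OF D(1), of M] A(1) by (intro sum_mono mult_left_mono) auto
    also have "\<dots> = 2 * real (card I) * A / real D * real N" by simp
    also have "\<dots> \<le> \<delta> * real N" using D(2) by (rule mult_right_mono) simp
    finally show ?thesis .
  qed
  show "\<exists>K Q n0. (\<forall>k<K. inj_on s (Q k) \<and> int_independent (s ` Q k)) \<and>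
     (\<forall>N\<ge>n0. real (card {n \<in> {1..N}. \<forall>k<(K::nat). n \<notin> Q k}) \<le> \<delta> * real N)"
    using QP bound by (intro exI[of _ "card P"] exI[of _ Q] exI[of _ 1]) simp
qed

end

theorem theorem1p4:
  fixes l :: nat and a b :: "nat \<Rightarrow> nat" and \<alpha> s :: "nat \<Rightarrow> real"
    and M :: "'a measure" and T :: "real \<Rightarrow> 'a \<Rightarrow> 'a" and \<epsilon> :: real
  assumes "l \<ge> 1"
    and "\<And>i. i \<in> {1..l} \<Longrightarrow> a i > 0 \<and> b i > 0 \<and> \<alpha> i = real (a i) / real (b i) \<and> \<alpha> i \<notin> \<int>"
    and "\<And>i j. i \<in> {1..l} \<Longrightarrow> j \<in> {1..l} \<Longrightarrow> i \<noteq> j \<Longrightarrow> gcd (b i) (b j) = 1"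
    and "strict_mono_on {1..} s"
    and "s ` {1..} = {(\<Prod>i=1..l. real (n i) powr \<alpha> i) | n :: nat \<Rightarrow> nat. \<forall>i\<in>{1..l}. n i \<ge> 1}"
    and "aperiodic_dynamical_system M T"
    and "\<epsilon> > 0"
  shows "\<exists>E \<in> sets M. measure M E < \<epsilon> \<and>
    (AE x in M. limsup (\<lambda>N. ereal (1 / real N * (\<Sum>n=1..N. indicator E (T (s n) x)))) = 1) \<and>
    (AE x in M. liminf (\<lambda>N. ereal (1 / real N * (\<Sum>n=1..N. indicator E (T (s n) x)))) = 0)"
proof -
  \<comment> \<open>Passing to lowest terms: coprimality of the denominators descends to their
    divisors \<open>b' i\<close>, and \<open>b' i = 1\<close> would make \<open>\<alpha> i\<close>
    an integer.\<close>
  define g where "g i = gcd (a i) (b i)" for i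
  define a' where "a' i = a i div g i" for i
  define b' where "b' i = b i div g i" for i
  have pos: "0 < a i" "0 < b i" "\<alpha> i = real (a i) / real (b i)" "\<alpha> i \<notin> \<int>" if "i \<in> {1..l}" for i
    using assms(2)[OF that] by auto
  have g: "0 < g i" "a i = g i * a' i" "b i = g i * b' i" if "i \<in> {1..l}" for i
    using pos(1)[OF that] unfolding g_def a'_def b'_def by simp_all
  have \<alpha>: "\<alpha> i = real (a' i) / real (b' i)" if "i \<in> {1..l}" for i
    unfolding pos(3)[OF that] g(2,3)[OF that] using g(1)[OF that] by simp
  interpret reduced_exponents "{1..l}" a' b' \<alpha>
  proof
    show "finite {1..l}" "{1..l} \<noteq> {}" using assms(1) by auto
  next
    fix i assume i: "i \<in> {1..l}"
    show "0 < a' i" using g(2)[OF i] pos(1)[OF i] by (cases "a' i") auto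
    show "coprime (a' i) (b' i)" unfolding a'_def b'_def g_def using pos(1)[OF i] by (intro div_gcd_coprime) simp
    show "\<alpha> i = real (a' i) / real (b' i)" by (rule \<alpha>[OF i])
    have "b' i \<noteq> 0" using g(3)[OF i] pos(2)[OF i] by (cases "b' i") auto
    moreover have "b' i \<noteq> 1"
    proof
      assume "b' i = 1"
      then have "\<alpha> i = real (a' i)" using \<alpha>[OF i] by simp
      then show False using pos(4)[OF i] by simp
    qed
    ultimately show "2 \<le> b' i" by simp
  next
    fix i j assume ij: "i \<in> {1..l}" "j \<in> {1..l}" "i \<noteq> j"
    have "b' i dvd b i" "b' j dvd b j" unfolding g(3)[OF ij(1)] g(3)[OF ij(2)] by simp_all
    moreover have "coprime (b i) (b j)" using assms(3)[OF ij] by (simp only: coprime_iff_gcd_eq_1)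
    ultimately show "coprime (b' i) (b' j)" by (rule coprime_divisors)
  qed
  interpret aperiodic_dynamical_system M T by (rule assms(6))
  have "indep_dense s"
    by (rule indep_dense_power_products[OF assms(4)]) (unfold \<Theta>_def, rule assms(5))
  from strong_sweeping_out[OF this assms(7)] show ?thesis unfolding avg_def .
qed

end
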